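(* Let $k$ be an algebraically closed field of characteristic zero, let $n\ge3$ and $R=k[x_1,\ldots,x_n]$. Let $\mathbf d=(d_1,d_2,d_3)$ with $1\le d_1\le d_2\le d_3$. For every integer $e$ with $$d_2<e\le d_1+d_2,$$ the pair $(e,(d_1+d_2-e)d_3)$ is realizable (for the degree vector $\mathbf d$ over $R$).
   Context: A pair $(e,j)\in\mathbb Z^2$ is realizable for $\mathbf d$ over $R=k[x_1,\ldots,x_n]$ if there exists an ideal $J=(f_1,f_2,f_3)\subseteq R$, minimally generated by homogeneous forms with $\deg f_i=d_i$ and $\gcd(f_1,f_2,f_3)=1$, such that $\mathrm{indeg}(\mathrm{Syz}(J))=e$ and $\deg(R/J)=j$. (The paper considers realizability of admissible pairs. With $D=d_1+d_2+d_3$, $\sigma=d_1d_2+d_1d_3+d_2d_3$ and $F_{\mathbf d}(e)=e^2-eD+\sigma$, a pair $(e,j)$ is admissible for $\mathbf d$ if $d_2<e\le d_1+d_2$ and $\max\{\sigma-eD,0\}\le j\le F_{\mathbf d}(e)$; every realizable pair is admissible.) $\mathrm{Syz}(J)$ is the kernel of $\bigoplus_{i=1}^3R(-d_i)\xrightarrow{[f_1\ f_2\ f_3]}J$, graded as a submodule of $\bigoplus_iR(-d_i)$ ("shifted" grading): a syzygy $(a_1,a_2,a_3)$ has shifted degree $q$ if $\deg a_i=q-d_i$ whenever $a_i\neq0$. $\mathrm{indeg}(\mathrm{Syz}(J))$ is the least $q$ with $\mathrm{Syz}(J)_q\ne0$. $\deg(R/J)$ is the codimension-two degree $\sum_{\mathfrak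 p\in\mathrm{Ass}(R/J),\,\mathrm{ht}\,\mathfrak p=2}\mathrm{length}((R/J)_{\mathfrak p})\deg(R/\mathfrak p)$: the usual multiplicity if $\mathrm{ht}(J)=2$, and $0$ if $\mathrm{ht}(J)\ge3$. *)

theory Defs
  imports
    "HOL-Library.Poly_Mapping"
    "HOL-Library.Extended_Real"
    "HOL-Computational_Algebra.Polynomial"
    "HOL-Algebra.QuotRing"
    "HOL-Algebra.Embedded_Algebras"
    "HOL-Algebra.Algebraic_Closure_Type"
begin

section \<open>Heights, associated primes, localization and length\<close>

definition height :: "('a, 'b) ring_scheme \<Rightarrow> 'a set \<Rightarrow> enat" where
  "height R p = Sup {enat l | l. \<exists>c :: nat \<Rightarrow> 'a set.
     (\<forall>i\<le>l. primeideal (c i) R) \<and> (\<forall>i<l. c i \<subset> c (Suc i)) \<and> c l = p}"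

text \<open>The associated primes of the \<open>R\<close>-module \<open>R/J\<close>: prime annihilators of classes \<open>x + J\<close>.\<close>

definition Ass_Quot :: "('a, 'b) ring_scheme \<Rightarrow> 'a set \<Rightarrow> 'a set set" where
  "Ass_Quot R J = {p. primeideal p R \<and>
     (\<exists>x\<in>carrier R. p = {r \<in> carrier R. r \<otimes>\<^bsub>R\<^esub> x \<in> J})}"

text \<open>Two fractions \<open>a/s\<close> and \<open>b/t\<close> agree iff \<open>u (t a - s b) = 0\<close> for some \<open>u \<in> S\<close>; the
  factor \<open>u\<close> is needed because the ring may have zero divisors.\<close>

definition frac_rel :: "('a, 'b) ring_scheme \<Rightarrow> 'a set \<Rightarrow> (('a \<times> 'a) \<times> ('a \<times> 'a)) set" where
  "frac_rel A S = {((a, s), (b, t)). a \<in> carrier A \<and> s \<in> S \<and> b \<in> carrier A \<and> t \<in> S \<and>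
     (\<exists>u\<in>S. u \<otimes>\<^bsub>A\<^esub> (t \<otimes>\<^bsub>A\<^esub> a \<ominus>\<^bsub>A\<^esub> s \<otimes>\<^bsub>A\<^esub> b) = \<zero>\<^bsub>A\<^esub>)}"

definition localization :: "('a, 'b) ring_scheme \<Rightarrow> 'a set \<Rightarrow> ('a \<times> 'a) set ring" where
  "localization A S =
    \<lparr>carrier = (carrier A \<times> S) // frac_rel A S,
     monoid.mult = (\<lambda>U V. \<Union>(a, s)\<in>U. \<Union>(b, t)\<in>V. frac_rel A S `` {(a \<otimes>\<^bsub>A\<^esub> b, s \<otimes>\<^bsub>A\<^esub> t)}),
     one = frac_rel A S `` {(\<one>\<^bsub>A\<^esub>, \<one>\<^bsub>A\<^esub>)},
     ring.zero = frac_rel A S `` {(\<zero>\<^bsub>A\<^esub>, \<one>\<^bsub>A\<^esub>)},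
     add = (\<lambda>U V. \<Union>(a, s)\<in>U. \<Union>(b, t)\<in>V.
              frac_rel A S `` {(a \<otimes>\<^bsub>A\<^esub> t \<oplus>\<^bsub>A\<^esub> b \<otimes>\<^bsub>A\<^esub> s, s \<otimes>\<^bsub>A\<^esub> t)})\<rparr>"

text \<open>\<open>(R/J)\<^sub>p\<close>, the quotient ring localized at the image of the complement of \<open>p\<close>.\<close>

definition quot_localized :: "('a, 'b) ring_scheme \<Rightarrow> 'a set \<Rightarrow> 'a set \<Rightarrow> ('a set \<times> 'a set) set ring" where
  "quot_localized R J p = localization (R Quot J) ((\<lambda>s. J +>\<^bsub>R\<^esub> s) ` (carrier R - p))"

text \<open>The length of a commutative ring as a module over itself. For \<open>(R/J)\<^sub>p\<close> this is also the
  length over \<open>R\<^sub>p\<close>, since \<open>R\<^sub>p \<rightarrow> (R/J)\<^sub>p\<close> is surjective.\<close>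

definition ring_length :: "('a, 'b) ring_scheme \<Rightarrow> enat" where
  "ring_length A = Sup {enat l | l. \<exists>c :: nat \<Rightarrow> 'a set.
     (\<forall>i\<le>l. ideal (c i) A) \<and> (\<forall>i<l. c i \<subset> c (Suc i))}"


section \<open>The graded polynomial ring\<close>

text \<open>\<open>k[x\<^sub>1,\<dots>,x\<^sub>n]\<close> is the type \<open>('n, 'k) mpoly\<close>, where \<open>n = card (UNIV :: 'n set)\<close>; a monomial is its
  exponent vector \<open>'n \<Rightarrow>\<^sub>0 nat\<close>.\<close>

type_synonym ('n, 'k) mpoly = "('n \<Rightarrow>\<^sub>0 nat) \<Rightarrow>\<^sub>0 'k"

abbreviation mpoly_ring :: "('n, 'k::comm_ring_1) mpoly ring" where
  "mpoly_ring \<equiv> ring_of_type_algebra"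

definition mon_degree :: "('n::finite \<Rightarrow>\<^sub>0 nat) \<Rightarrow> nat" where
  "mon_degree m = (\<Sum>i\<in>UNIV. Poly_Mapping.lookup m i)"

text \<open>Degrees are integers, so that \<open>0\<close> is the only form of a negative degree; \<open>0\<close> is a form of
  every degree.\<close>

definition homogeneous :: "int \<Rightarrow> ('n::finite, 'k::zero) mpoly \<Rightarrow> bool" where
  "homogeneous q f \<longleftrightarrow> (\<forall>m\<in>Poly_Mapping.keys f. int (mon_degree m) = q)"

text \<open>\<open>dim\<^sub>k (R/I)\<^sub>t\<close> for a homogeneous ideal \<open>I\<close>, where \<open>(R/I)\<^sub>t\<close> is the image of the forms of
  degree \<open>t\<close> in the \<open>k\<close>-algebra \<open>R/I\<close>.\<close>

definition hilbert_function :: "('n::finite, 'k::field) mpoly set \<Rightarrow> nat \<Rightarrow> nat" where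
  "hilbert_function I t = ring.dim (mpoly_ring Quot I)
     (range (\<lambda>c. I +>\<^bsub>mpoly_ring\<^esub> Poly_Mapping.single 0 c))
     ((\<lambda>f. I +>\<^bsub>mpoly_ring\<^esub> f) ` {f. homogeneous (int t) f})"

definition hilbert_polynomial :: "('n::finite, 'k::field) mpoly set \<Rightarrow> real poly" where
  "hilbert_polynomial I =
     (THE P. \<forall>\<^sub>F t in sequentially. poly P (real t) = real (hilbert_function I t))"

text \<open>The multiplicity \<open>deg (R/I)\<close>; the first case is \<open>dim (R/I) = 0\<close>, where it is \<open>dim\<^sub>k (R/I)\<close>.\<close>

definition multiplicity_quot :: "('n::finite, 'k::field) mpoly set \<Rightarrow> real" where
  "multiplicity_quot I =
     (let P = hilbert_polynomial I in
      if P = 0 then real (\<Sum>t | hilbert_function I t \<noteq> 0. hilbert_function I t)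
      else fact (degree P) * lead_coeff P)"

text \<open>The index set below is finite because \<open>R\<close> is Noetherian.\<close>

definition codim2_degree :: "('n::finite, 'k::field) mpoly set \<Rightarrow> ereal" where
  "codim2_degree J = (\<Sum>p | p \<in> Ass_Quot mpoly_ring J \<and> height mpoly_ring p = 2.
     ereal_of_enat (ring_length (quot_localized mpoly_ring J p)) * ereal (multiplicity_quot p))"


section \<open>Realizable pairs\<close>

text \<open>The component of shifted degree \<open>q\<close> of \<open>Syz (f\<^sub>1, f\<^sub>2, f\<^sub>3) \<subseteq> R(-d\<^sub>1) \<oplus> R(-d\<^sub>2) \<oplus> R(-d\<^sub>3)\<close>.\<close>

fun syz_component :: "int \<times> int \<times> int \<Rightarrow>
    ('n::finite, 'k::field) mpoly \<times> ('n, 'k) mpoly \<times> ('n, 'k) mpoly \<Rightarrow> int \<Rightarrow>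
    (('n, 'k) mpoly \<times> ('n, 'k) mpoly \<times> ('n, 'k) mpoly) set" where
  "syz_component (d1, d2, d3) (f1, f2, f3) q = {(a1, a2, a3).
     homogeneous (q - d1) a1 \<and> homogeneous (q - d2) a2 \<and> homogeneous (q - d3) a3 \<and>
     a1 * f1 + a2 * f2 + a3 * f3 = 0}"

definition indeg_syz :: "int \<times> int \<times> int \<Rightarrow>
    ('n::finite, 'k::field) mpoly \<times> ('n, 'k) mpoly \<times> ('n, 'k) mpoly \<Rightarrow> int" where
  "indeg_syz d f = (LEAST q. syz_component d f q \<noteq> {(0, 0, 0)})"

definition minimally_generates ::
  "('n, 'k::field) mpoly \<times> ('n, 'k) mpoly \<times> ('n, 'k) mpoly \<Rightarrow> ('n, 'k) mpoly set \<Rightarrow> bool" where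
  "minimally_generates = (\<lambda>(f1, f2, f3) J.
     J = Idl\<^bsub>mpoly_ring\<^esub> {f1, f2, f3} \<and>
     Idl\<^bsub>mpoly_ring\<^esub> {f2, f3} \<noteq> J \<and> Idl\<^bsub>mpoly_ring\<^esub> {f1, f3} \<noteq> J \<and> Idl\<^bsub>mpoly_ring\<^esub> {f1, f2} \<noteq> J)"

text \<open>The first two arguments fix the ring \<open>k[x\<^sub>1,\<dots>,x\<^sub>n]\<close>. The conditions \<open>deg f\<^sub>i = d\<^sub>i\<close> need no
  separate \<open>f\<^sub>i \<noteq> 0\<close>, which follows from minimal generation.\<close>

definition realizable ::
  "'n::finite itself \<Rightarrow> 'k::field itself \<Rightarrow> int \<times> int \<times> int \<Rightarrow> int \<times> int \<Rightarrow> bool" where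
  "realizable _ _ = (\<lambda>(d1, d2, d3) (e, j).
     \<exists>(J :: ('n, 'k) mpoly set) f1 f2 f3.
       minimally_generates (f1, f2, f3) J \<and>
       homogeneous d1 f1 \<and> homogeneous d2 f2 \<and> homogeneous d3 f3 \<and>
       (\<forall>g. g dvd f1 \<and> g dvd f2 \<and> g dvd f3 \<longrightarrow> g dvd 1) \<and>
       indeg_syz (d1, d2, d3) (f1, f2, f3) = e \<and>
       codim2_degree J = ereal (real_of_int j))"

end

theory Submission
  imports Defs
begin

text \<open>
  With \<open>c = d\<^sub>1 + d\<^sub>2 - e\<close>, so that \<open>0 \<le> c < d\<^sub>1\<close>, the monomials \<open>f\<^sub>1 = x ^ d\<^sub>1\<close>,
  \<open>f\<^sub>2 = x ^ c * y ^ (d\<^sub>2 - c)\<close> and \<open>f\<^sub>3 = z ^ d\<^sub>3\<close> realize the pair. The first two share the factor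
  \<open>x ^ c\<close>, so their Koszul relation drops to degree \<open>d\<^sub>1 + d\<^sub>2 - c = e\<close>, and comparing monomials shows that
  no relation has smaller degree. An associated prime of height two contains \<open>x\<close> and \<open>z\<close>, hence equals
  \<open>(x, z)\<close>; it occurs iff \<open>c > 0\<close>. There \<open>y\<close> is invertible, so the localization of \<open>R/J\<close> is that of
  \<open>R/(x ^ c, z ^ d\<^sub>3)\<close>, of length \<open>c d\<^sub>3\<close>, and \<open>R/(x, z)\<close> is a polynomial ring, of multiplicity one.
\<close>

section \<open>Ideals of a commutative ring given by a type\<close>

text \<open>The forms \<open>f1\<close>, \<open>f2\<close> are \<open>x ^ c\<close> times the
  coprime pair \<open>x ^ (d1 - c)\<close>, \<open>y ^ (d2 - c)\<close>. The common zeros of that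
  pair have codimension three once \<open>z ^ d3 = 0\<close> is imposed, so only the factor
  \<open>x ^ c\<close> contributes in codimension two, and it contributes \<open>c * d3\<close>.
  With monomials, membership, minimality and relations become statements on exponent sets, but two
  points concern arbitrary ideals and are not combinatorial. The height of \<open>(x, z)\<close>
  bounds chains of arbitrary primes; it is obtained by eliminating one variable at a time with
  pseudo-division. The length bounds chains of arbitrary ideals of the localization; these are
  contracted to \<open>R\<close>, and a contracted ideal is measured by the set of filtration steps
  at which it has an element of exactly that order. This set grows strictly along a chain, which
  takes the place of composition series.\<close>

lemma type_ring_simps [simp]:
  "carrier (ring_of_type_algebra :: 'a::comm_ring_1 ring) = UNIV"
  "x \<otimes>\<^bsub>ring_of_type_algebra\<^esub> y = x * y"
  "x \<oplus>\<^bsub>ring_of_type_algebra\<^esub> y = x + y"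
  "\<one>\<^bsub>ring_of_type_algebra\<^esub> = (1 :: 'a)"
  "\<zero>\<^bsub>ring_of_type_algebra\<^esub> = (0 :: 'a)"
  by (simp_all add: ring_of_type_algebra_def)

lemma type_ring_minus [simp]:
  fixes x y :: "'a::comm_ring_1"
  shows "\<ominus>\<^bsub>ring_of_type_algebra\<^esub> x = - x" "x \<ominus>\<^bsub>ring_of_type_algebra\<^esub> y = x - y"
proof -
  interpret cring "ring_of_type_algebra :: 'a ring" by (rule cring_from_type_algebra)
  show *: "\<ominus>\<^bsub>ring_of_type_algebra\<^esub> x = - x" for x :: 'a
    using minus_equality[of "- x" x] by simp
  show "x \<ominus>\<^bsub>ring_of_type_algebra\<^esub> y = x - y"
    using * by (simp add: a_minus_def)
qed

lemma ideal_type_ring_iff: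
  fixes I :: "'a::comm_ring_1 set"
  shows "ideal I ring_of_type_algebra \<longleftrightarrow>
    0 \<in> I \<and> (\<forall>a\<in>I. \<forall>b\<in>I. a + b \<in> I) \<and> (\<forall>a\<in>I. \<forall>r. r * a \<in> I)" (is "_ \<longleftrightarrow> ?R")
proof
  assume "ideal I ring_of_type_algebra"
  then interpret ideal I "ring_of_type_algebra" .
  show ?R using I_l_closed additive_subgroup.zero_closed[OF additive_subgroup_axioms] additive_subgroup.a_closed[OF additive_subgroup_axioms]
    by (simp add: ring_of_type_algebra_def)
next
  assume R: ?R
  interpret cring "ring_of_type_algebra :: 'a ring" by (rule cring_from_type_algebra)
  show "ideal I ring_of_type_algebra"
  proof (rule idealI)
    show "subgroup I (add_monoid ring_of_type_algebra)"
    proof (rule subgroup.intro)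
      show "inv\<^bsub>add_monoid ring_of_type_algebra\<^esub> x \<in> I" if "x \<in> I" for x
      proof -
        have "(-1) * x \<in> I" using R that by blast
        then show ?thesis using type_ring_minus(1)[of x] by (simp only: a_inv_def) simp
      qed
    qed (use R in auto)
  qed (use R in \<open>auto simp: mult.commute ring_axioms\<close>)
qed

lemma ideal_type_ringI:
  fixes I :: "'a::comm_ring_1 set"
  assumes "0 \<in> I" "\<And>a b. a \<in> I \<Longrightarrow> b \<in> I \<Longrightarrow> a + b \<in> I" "\<And>a r. a \<in> I \<Longrightarrow> r * a \<in> I"
  shows "ideal I ring_of_type_algebra"
  using assms by (auto simp: ideal_type_ring_iff)

lemma ideal_type_ringD:
  fixes I :: "'a::comm_ring_1 set"
  assumes "ideal I ring_of_type_algebra"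
  shows "0 \<in> I" "a \<in> I \<Longrightarrow> b \<in> I \<Longrightarrow> a + b \<in> I" "a \<in> I \<Longrightarrow> r * a \<in> I" "a \<in> I \<Longrightarrow> a * r \<in> I"
    "a \<in> I \<Longrightarrow> - a \<in> I" "a \<in> I \<Longrightarrow> b \<in> I \<Longrightarrow> a - b \<in> I"
proof -
  note * = assms[unfolded ideal_type_ring_iff]
  show "0 \<in> I" "a \<in> I \<Longrightarrow> b \<in> I \<Longrightarrow> a + b \<in> I" "a \<in> I \<Longrightarrow> r * a \<in> I" "a \<in> I \<Longrightarrow> a * r \<in> I"
    using * by (auto simp: mult.commute)
  show m: "a \<in> I \<Longrightarrow> - a \<in> I" for a
    using * mult_minus1[of a] by metis
  show "a \<in> I \<Longrightarrow> b \<in> I \<Longrightarrow> a - b \<in> I"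
    using * m[of b] by (metis diff_conv_add_uminus)
qed

lemma ideal_type_ring_sum:
  fixes I :: "'a::comm_ring_1 set"
  assumes "ideal I ring_of_type_algebra" "\<And>i. i \<in> A \<Longrightarrow> g i \<in> I"
  shows "sum g A \<in> I"
  using assms(2) by (induction A rule: infinite_finite_induct) (auto intro: ideal_type_ringD[OF assms(1)])

lemma primeideal_type_ring_iff:
  fixes I :: "'a::comm_ring_1 set"
  shows "primeideal I ring_of_type_algebra \<longleftrightarrow>
    ideal I ring_of_type_algebra \<and> 1 \<notin> I \<and> (\<forall>a b. a * b \<in> I \<longrightarrow> a \<in> I \<or> b \<in> I)" (is "_ \<longleftrightarrow> ?R")
proof
  assume "primeideal I ring_of_type_algebra"
  then interpret primeideal I "ring_of_type_algebra" .
  show ?R using I_prime I_notcarr one_imp_carrier ideal_axioms by auto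
next
  assume R: ?R
  show "primeideal I ring_of_type_algebra"
    by (rule primeidealI) (use R in \<open>auto simp: cring_from_type_algebra\<close>)
qed

lemma primeideal_type_ringD:
  fixes I :: "'a::comm_ring_1 set"
  assumes "primeideal I ring_of_type_algebra"
  shows "ideal I ring_of_type_algebra" "1 \<notin> I" "a * b \<in> I \<Longrightarrow> a \<in> I \<or> b \<in> I" "a ^ n \<in> I \<Longrightarrow> a \<in> I"
proof -
  note * = assms[unfolded primeideal_type_ring_iff]
  show "ideal I ring_of_type_algebra" "1 \<notin> I" "a * b \<in> I \<Longrightarrow> a \<in> I \<or> b \<in> I" using * by auto
  show "a ^ n \<in> I \<Longrightarrow> a \<in> I" by (induction n) (use * in auto)
qed

section \<open>Monomials and zero divisors\<close>

lemma poly_mapping_sum_single: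
  "f = (\<Sum>m\<in>Poly_Mapping.keys f. Poly_Mapping.single m (Poly_Mapping.lookup f m))"
  by (rule poly_mapping_eqI) (simp add: lookup_sum lookup_single when_def sum.delta' in_keys_iff)

definition restr :: "'a set \<Rightarrow> ('a \<Rightarrow>\<^sub>0 'b::comm_monoid_add) \<Rightarrow> 'a \<Rightarrow>\<^sub>0 'b" where
  "restr A f = (\<Sum>m\<in>Poly_Mapping.keys f \<inter> A. Poly_Mapping.single m (Poly_Mapping.lookup f m))"

lemma lookup_restr: "Poly_Mapping.lookup (restr A f) m = (if m \<in> A then Poly_Mapping.lookup f m else 0)"
  by (auto simp: restr_def lookup_sum lookup_single when_def sum.delta' in_keys_iff)

lemma keys_restr [simp]: "Poly_Mapping.keys (restr A f) = Poly_Mapping.keys f \<inter> A"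
  by (auto simp: in_keys_iff lookup_restr split: if_splits)

lemma restr_add_restr_Compl: "restr A f + restr (- A) f = f"
  by (rule poly_mapping_eqI) (simp add: lookup_add lookup_restr)

lemma keys_minus_poly: "Poly_Mapping.keys (f - g) \<subseteq> Poly_Mapping.keys f \<union> Poly_Mapping.keys (g :: 'a \<Rightarrow>\<^sub>0 'b::ab_group_add)"
  by (auto simp: in_keys_iff lookup_minus)

text \<open>Split the term at \<open>m\<close> off \<open>f\<close> and the term at
  \<open>m'\<close> off \<open>g\<close>: since \<open>m + m'\<close> decomposes in only one way,
  only the product of these two terms reaches it.\<close>

lemma lookup_mult_unique:
  fixes f g :: "'a::comm_monoid_add \<Rightarrow>\<^sub>0 'b::comm_semiring_0"
  assumes "\<And>l l'. l \<in> Poly_Mapping.keys f \<Longrightarrow> l' \<in> Poly_Mapping.keys g \<Longrightarrow> l + l' = m + m' \<Longrightarrow> l = m \<and> l' = m'"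
  shows "Poly_Mapping.lookup (f * g) (m + m') = Poly_Mapping.lookup f m * Poly_Mapping.lookup g m'"
proof -
  let ?A = "restr {m} f" and ?B = "restr {m'} g"
  have s: "restr {a} h = Poly_Mapping.single a (Poly_Mapping.lookup h a)" for a and h :: "'a \<Rightarrow>\<^sub>0 'b"
    by (rule poly_mapping_eqI) (auto simp: lookup_restr lookup_single when_def)
  have z: "Poly_Mapping.lookup (u * v) (m + m') = 0"
    if "\<And>l l'. l \<in> Poly_Mapping.keys u \<Longrightarrow> l' \<in> Poly_Mapping.keys v \<Longrightarrow> l + l' \<noteq> m + m'" for u v :: "'a \<Rightarrow>\<^sub>0 'b"
  proof (rule ccontr)
    assume "Poly_Mapping.lookup (u * v) (m + m') \<noteq> 0"
    then have "m + m' \<in> {a + b | a b. a \<in> Poly_Mapping.keys u \<and> b \<in> Poly_Mapping.keys v}"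
      using keys_mult[of u v] unfolding in_keys_iff[symmetric] by blast
    then obtain a b where "a \<in> Poly_Mapping.keys u" "b \<in> Poly_Mapping.keys v" "m + m' = a + b" by blast
    then show False using that[of a b] by simp
  qed
  have "f * g = (?A + restr (- {m}) f) * g" by (simp only: restr_add_restr_Compl)
  also have "\<dots> = ?A * (?B + restr (- {m'}) g) + restr (- {m}) f * g"
    by (simp only: restr_add_restr_Compl[of "{m'}" g] distrib_right)
  finally have "f * g = ?A * ?B + (?A * restr (- {m'}) g + restr (- {m}) f * g)"
    by (simp only: distrib_left add.assoc)
  moreover have "Poly_Mapping.lookup (?A * restr (- {m'}) g) (m + m') = 0"
    by (rule z) (use assms in auto)
  moreover have "Poly_Mapping.lookup (restr (- {m}) f * g) (m + m') = 0"
    by (rule z) (use assms in auto)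
  ultimately show ?thesis
    by (simp add: lookup_add s mult_single)
qed

lemma lookup_mult_single:
  fixes f :: "'a::cancel_comm_monoid_add \<Rightarrow>\<^sub>0 'b::comm_semiring_1"
  shows "Poly_Mapping.lookup (f * Poly_Mapping.single m c) (l + m) = Poly_Mapping.lookup f l * c"
  by (subst lookup_mult_unique) (auto split: if_splits)

lemma keys_mult_single:
  fixes f :: "'a::cancel_comm_monoid_add \<Rightarrow>\<^sub>0 'b::comm_semiring_1"
  shows "Poly_Mapping.keys (f * Poly_Mapping.single m 1) = (\<lambda>l. l + m) ` Poly_Mapping.keys f"
proof
  show "Poly_Mapping.keys (f * Poly_Mapping.single m 1) \<subseteq> (\<lambda>l. l + m) ` Poly_Mapping.keys f"
    using keys_mult[of f "Poly_Mapping.single m 1"] by (auto split: if_splits)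
  show "(\<lambda>l. l + m) ` Poly_Mapping.keys f \<subseteq> Poly_Mapping.keys (f * Poly_Mapping.single m 1)"
    by (auto simp: in_keys_iff lookup_mult_single)
qed

text \<open>Unique factorization turns monomials into numbers: \<open>m \<mapsto> \<Prod> p\<^sub>i ^ m\<^sub>i\<close> for distinct primes
  \<open>p\<^sub>i\<close> is a multiplicative embedding. It serves as a monomial order and needs no order on the variables.\<close>

definition mon_code :: "('n::finite \<Rightarrow>\<^sub>0 nat) \<Rightarrow> nat" where
  "mon_code m = (let p = (SOME p :: 'n \<Rightarrow> nat. inj p \<and> (\<forall>i. prime (p i)))
    in \<Prod>i\<in>UNIV. p i ^ Poly_Mapping.lookup m i)"

text \<open>Infinitely many primes make the choice in \<open>mon_code\<close> possible. Injectivity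
  holds because the multiplicity of the \<open>i\<close>-th prime in the code is the exponent of the
  \<open>i\<close>-th variable.\<close>

lemma mon_code_props:
  fixes m m' :: "'n::finite \<Rightarrow>\<^sub>0 nat"
  shows "mon_code m > 0" "mon_code (m + m') = mon_code m * mon_code m'" "inj (mon_code :: ('n \<Rightarrow>\<^sub>0 nat) \<Rightarrow> nat)"
proof -
  define p where "p = (SOME p :: 'n \<Rightarrow> nat. inj p \<and> (\<forall>i. prime (p i)))"
  obtain P where P: "P \<subseteq> {p::nat. prime p}" "finite P" "card P = card (UNIV :: 'n set)"
    using infinite_arbitrarily_large[OF primes_infinite] by blast
  then obtain q where "bij_betw q (UNIV :: 'n set) P"
    using finite_same_card_bij[of "UNIV :: 'n set" P] by auto
  then have "inj q \<and> (\<forall>i. prime (q i))"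
    using P by (auto simp: bij_betw_def)
  then have p: "inj p" "\<And>i. prime (p i)"
    unfolding p_def by (rule someI2[of _ q]; blast)+
  have c: "mon_code m = (\<Prod>i\<in>UNIV. p i ^ Poly_Mapping.lookup m i)" for m :: "'n \<Rightarrow>\<^sub>0 nat"
    by (simp add: mon_code_def p_def Let_def)
  show "mon_code m > 0"
    unfolding c by (rule prod_pos) (use p(2) prime_gt_0_nat in auto)
  show "mon_code (m + m') = mon_code m * mon_code m'"
    unfolding c by (simp add: lookup_add power_add prod.distrib)
  show "inj (mon_code :: ('n \<Rightarrow>\<^sub>0 nat) \<Rightarrow> nat)"
  proof (rule injI, rule poly_mapping_eqI)
    fix m m' :: "'n \<Rightarrow>\<^sub>0 nat" and i assume eq: "mon_code m = mon_code m'"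
    have "multiplicity (p i) (mon_code m) = Poly_Mapping.lookup m i" for m :: "'n \<Rightarrow>\<^sub>0 nat"
    proof -
      have p0: "p j \<noteq> 0" for j
        using prime_gt_0_nat[OF p(2), of j] by simp
      have ne: "p j ^ Poly_Mapping.lookup m j \<noteq> 0" for j
        using prime_gt_0_nat[OF p(2), of j] by simp
      have "multiplicity (p i) (mon_code m) = (\<Sum>j\<in>UNIV. multiplicity (p i) (p j ^ Poly_Mapping.lookup m j))"
        unfolding c by (rule prime_elem_multiplicity_prod_distrib) (auto simp: p0 p(2) prime_imp_prime_elem)
      also have "\<dots> = (\<Sum>j\<in>UNIV. if j = i then Poly_Mapping.lookup m i else 0)"
      proof (rule sum.cong)
        fix j
        have "multiplicity (p i) (p j) = 0" if "j \<noteq> i"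
          using that p primes_dvd_imp_eq[OF p(2)[of i] p(2)[of j]] by (metis injD not_dvd_imp_multiplicity_0)
        then show "multiplicity (p i) (p j ^ Poly_Mapping.lookup m j) = (if j = i then Poly_Mapping.lookup m i else 0)"
          using p(2) by (auto simp: p0 prime_elem_multiplicity_power_distrib)
      qed simp
      finally show ?thesis by simp
    qed
    then show "Poly_Mapping.lookup m i = Poly_Mapping.lookup m' i" using eq by metis
  qed
qed

lemma finite_max_min_obtains:
  fixes h :: "'a \<Rightarrow> nat"
  assumes "finite A" "A \<noteq> {}"
  obtains a b where "a \<in> A" "b \<in> A" "\<And>l. l \<in> A \<Longrightarrow> h l \<le> h a" "\<And>l. l \<in> A \<Longrightarrow> h b \<le> h l"
proof -
  have "Max (h ` A) \<in> h ` A" "Min (h ` A) \<in> h ` A" using assms by auto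
  then obtain a b where "a \<in> A" "b \<in> A" "h a = Max (h ` A)" "h b = Min (h ` A)" by auto
  then show ?thesis using that[of a b] assms by simp
qed

text \<open>If \<open>l + l' = m + m'\<close>, the codes have equal products; when both factors are
  compared in the same direction, they must agree, and injectivity gives \<open>l = m\<close>. The
  disjunction covers largest and smallest terms at once.\<close>

lemma mon_code_mult_extremal:
  fixes f g :: "('n::finite \<Rightarrow>\<^sub>0 nat) \<Rightarrow>\<^sub>0 'k::idom"
  assumes m: "m \<in> Poly_Mapping.keys f" and m': "m' \<in> Poly_Mapping.keys g"
    and ext: "(\<forall>l\<in>Poly_Mapping.keys f. mon_code l \<le> mon_code m) \<and> (\<forall>l\<in>Poly_Mapping.keys g. mon_code l \<le> mon_code m') \<or>
      (\<forall>l\<in>Poly_Mapping.keys f. mon_code m \<le> mon_code l) \<and> (\<forall>l\<in>Poly_Mapping.keys g. mon_code m' \<le> mon_code l)"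
  shows "m + m' \<in> Poly_Mapping.keys (f * g)"
proof -
  have "l = m \<and> l' = m'" if "l \<in> Poly_Mapping.keys f" "l' \<in> Poly_Mapping.keys g" "l + l' = m + m'" for l l'
  proof -
    have e: "mon_code l * mon_code l' = mon_code m * mon_code m'"
      using that(3) by (metis mon_code_props(2))
    have pos: "0 < mon_code l" "0 < mon_code m" "0 < mon_code l'" "0 < mon_code m'"
      by (rule mon_code_props)+
    have "mon_code l = mon_code m"
      using ext
    proof
      assume a: "(\<forall>l\<in>Poly_Mapping.keys f. mon_code l \<le> mon_code m) \<and> (\<forall>l\<in>Poly_Mapping.keys g. mon_code l \<le> mon_code m')"
      then have "mon_code l \<le> mon_code m" "mon_code l' \<le> mon_code m'" using that by auto
      then show ?thesis
        using e pos mult_less_le_imp_less[of "mon_code l" "mon_code m" "mon_code l'" "mon_code m'"] by force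
    next
      assume a: "(\<forall>l\<in>Poly_Mapping.keys f. mon_code m \<le> mon_code l) \<and> (\<forall>l\<in>Poly_Mapping.keys g. mon_code m' \<le> mon_code l)"
      then have "mon_code m \<le> mon_code l" "mon_code m' \<le> mon_code l'" using that by auto
      then show ?thesis
        using e pos mult_less_le_imp_less[of "mon_code m" "mon_code l" "mon_code m'" "mon_code l'"] by force
    qed
    then show ?thesis using that(3) by (auto simp: inj_eq[OF mon_code_props(3)])
  qed
  then show ?thesis
    using m m' lookup_mult_unique[of f g m m'] by (simp add: in_keys_iff)
qed

text \<open>The product of the two terms of largest code cannot cancel.\<close>

lemma mpoly_mult_eq_0_iff:
  fixes f g :: "('n::finite \<Rightarrow>\<^sub>0 nat) \<Rightarrow>\<^sub>0 'k::idom"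
  shows "f * g = 0 \<longleftrightarrow> f = 0 \<or> g = 0"
proof (intro iffI)
  assume fg: "f * g = 0"
  show "f = 0 \<or> g = 0"
  proof (rule ccontr)
    assume "\<not> (f = 0 \<or> g = 0)"
    then have ne: "Poly_Mapping.keys f \<noteq> {}" "Poly_Mapping.keys g \<noteq> {}"
      by (auto simp: poly_mapping_eq_iff fun_eq_iff)
  obtain m m2 where mf: "m \<in> Poly_Mapping.keys f" "m2 \<in> Poly_Mapping.keys f"
      "\<And>l. l \<in> Poly_Mapping.keys f \<Longrightarrow> mon_code l \<le> mon_code m" "\<And>l. l \<in> Poly_Mapping.keys f \<Longrightarrow> mon_code m2 \<le> mon_code l"
  using ne by (rule_tac finite_max_min_obtains[of "Poly_Mapping.keys f" mon_code]) auto
  obtain m' n2 where ng: "m' \<in> Poly_Mapping.keys g" "n2 \<in> Poly_Mapping.keys g"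
      "\<And>l. l \<in> Poly_Mapping.keys g \<Longrightarrow> mon_code l \<le> mon_code m'" "\<And>l. l \<in> Poly_Mapping.keys g \<Longrightarrow> mon_code n2 \<le> mon_code l"
    using ne by (rule_tac finite_max_min_obtains[of "Poly_Mapping.keys g" mon_code]) auto
    have "m + m' \<in> Poly_Mapping.keys (f * g)"
      by (intro mon_code_mult_extremal) (use mf ng in auto)
    then show False using fg by simp
  qed
qed auto

lemma mpoly_power_eq_0_iff:
  fixes f :: "('n::finite \<Rightarrow>\<^sub>0 nat) \<Rightarrow>\<^sub>0 'k::idom"
  shows "f ^ n = 0 \<longleftrightarrow> f = 0 \<and> n > 0"
  by (induction n) (auto simp: mpoly_mult_eq_0_iff)

text \<open>With a cofactor \<open>h\<close>, the largest terms of \<open>g\<close> and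
  \<open>h\<close> and their smallest terms both survive in \<open>g * h\<close>, which has a single
  term. Hence the largest and smallest terms of \<open>g\<close> coincide.\<close>

lemma dvd_single_obtains:
  fixes g :: "('n::finite \<Rightarrow>\<^sub>0 nat) \<Rightarrow>\<^sub>0 'k::idom"
  assumes "g dvd Poly_Mapping.single l c" "c \<noteq> 0"
  obtains m a m' where "g = Poly_Mapping.single m a" "a \<noteq> 0" "l = m + m'"
proof -
  obtain h where h: "Poly_Mapping.single l c = g * h" using assms(1) by (elim dvdE)
  have k: "Poly_Mapping.keys (g * h) = {l}" using assms(2) by (simp flip: h)
  then have ne: "Poly_Mapping.keys g \<noteq> {}" "Poly_Mapping.keys h \<noteq> {}" by auto
  obtain m1 m2 where mg: "m1 \<in> Poly_Mapping.keys g" "m2 \<in> Poly_Mapping.keys g"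
      "\<And>l. l \<in> Poly_Mapping.keys g \<Longrightarrow> mon_code l \<le> mon_code m1" "\<And>l. l \<in> Poly_Mapping.keys g \<Longrightarrow> mon_code m2 \<le> mon_code l"
    using ne by (rule_tac finite_max_min_obtains[of "Poly_Mapping.keys g" mon_code]) auto
  obtain n1 n2 where nh: "n1 \<in> Poly_Mapping.keys h" "n2 \<in> Poly_Mapping.keys h"
      "\<And>l. l \<in> Poly_Mapping.keys h \<Longrightarrow> mon_code l \<le> mon_code n1" "\<And>l. l \<in> Poly_Mapping.keys h \<Longrightarrow> mon_code n2 \<le> mon_code l"
    using ne by (rule_tac finite_max_min_obtains[of "Poly_Mapping.keys h" mon_code]) auto
  have e: "m1 + n1 \<in> Poly_Mapping.keys (g * h)" "m2 + n2 \<in> Poly_Mapping.keys (g * h)"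
    by (intro mon_code_mult_extremal; use mg nh in auto)+
  then have eq: "m1 + n1 = l" "m2 + n2 = l" using k by auto
  then have "mon_code m1 * mon_code n1 = mon_code m2 * mon_code n2"
    by (metis mon_code_props(2))
  moreover have "mon_code m2 \<le> mon_code m1" "mon_code n2 \<le> mon_code n1"
    using mg nh by auto
  moreover have "0 < mon_code m1" "0 < mon_code n1" "0 < mon_code m2" "0 < mon_code n2" by (rule mon_code_props)+
  ultimately have "mon_code m1 = mon_code m2"
    using mult_less_le_imp_less[of "mon_code m2" "mon_code m1" "mon_code n2" "mon_code n1"] by force
  then have "mon_code m = mon_code m1" if "m \<in> Poly_Mapping.keys g" for m
    using mg(3,4)[OF that] by simp
  then have "m = m1" if "m \<in> Poly_Mapping.keys g" for m
    using that mon_code_props(3) by (auto dest: injD)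
  then have "g = Poly_Mapping.single m1 (Poly_Mapping.lookup g m1)"
    by (intro poly_mapping_eqI) (metis in_keys_iff lookup_single_eq lookup_single_not_eq)
  moreover have "Poly_Mapping.lookup g m1 \<noteq> 0"
    using mg(1) by (simp add: in_keys_iff)
  ultimately show ?thesis using that eq by blast
qed

section \<open>Monomial ideals\<close>

text \<open>For an upset \<open>A\<close> this is a monomial ideal. Other choices of
  \<open>A\<close> give the polynomials free of certain variables and those of bounded degree in one
  variable.\<close>

definition supported :: "'a set \<Rightarrow> ('a \<Rightarrow>\<^sub>0 'b::zero) set" where
  "supported A = {f. Poly_Mapping.keys f \<subseteq> A}"

definition upset :: "'a::plus set \<Rightarrow> bool" where
  "upset A \<longleftrightarrow> (\<forall>m\<in>A. \<forall>l. l + m \<in> A)"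

lemma supported_add: "f \<in> supported A \<Longrightarrow> g \<in> supported A \<Longrightarrow> f + g \<in> supported A"
  using keys_add[of f g] by (auto simp: supported_def)

lemma supported_diff:
  fixes f g :: "'a \<Rightarrow>\<^sub>0 'b::ab_group_add"
  shows "f \<in> supported A \<Longrightarrow> g \<in> supported A \<Longrightarrow> f - g \<in> supported A"
  using keys_minus_poly[of f g] by (auto simp: supported_def)

lemma supported_zero [simp]: "0 \<in> supported A"
  by (simp add: supported_def)

lemma supported_empty [simp]: "supported {} = {0}"
  by (auto simp: supported_def)

lemma supported_single [simp]: "Poly_Mapping.single m c \<in> supported A \<longleftrightarrow> c = 0 \<or> m \<in> A"
  by (auto simp: supported_def)

lemma supported_one [simp]: "(1 :: 'a::zero \<Rightarrow>\<^sub>0 'b::zero_neq_one) \<in> supported A \<longleftrightarrow> 0 \<in> A"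
  by (simp add: supported_def)

lemma supported_mono: "A \<subseteq> B \<Longrightarrow> supported A \<subseteq> supported B"
  by (auto simp: supported_def)

lemma supported_mult:
  fixes f g :: "'a::monoid_add \<Rightarrow>\<^sub>0 'b::semiring_0"
  assumes "f \<in> supported A" "g \<in> supported B" "\<And>a b. a \<in> A \<Longrightarrow> b \<in> B \<Longrightarrow> a + b \<in> C"
  shows "f * g \<in> supported C"
  using keys_mult[of f g] assms by (auto simp: supported_def subset_iff)

lemma ideal_supported:
  assumes "upset A"
  shows "ideal (supported A :: ('a::comm_monoid_add \<Rightarrow>\<^sub>0 'b::comm_ring_1) set) ring_of_type_algebra"
proof (rule ideal_type_ringI)
  fix a r :: "'a \<Rightarrow>\<^sub>0 'b"
  assume "a \<in> supported A"
  then show "r * a \<in> supported A"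
    by (rule supported_mult[of r UNIV a A A, rotated]) (use assms in \<open>auto simp: upset_def supported_def\<close>)
qed (auto intro: supported_add)

lemma supported_subset_ideal:
  fixes I :: "('a::comm_monoid_add \<Rightarrow>\<^sub>0 'b::comm_ring_1) set"
  assumes I: "ideal I ring_of_type_algebra" and A: "\<And>m. m \<in> A \<Longrightarrow> Poly_Mapping.single m 1 \<in> I"
  shows "supported A \<subseteq> I"
proof
  fix f :: "'a \<Rightarrow>\<^sub>0 'b"
  assume f: "f \<in> supported A"
  have "Poly_Mapping.single m c \<in> I" if "m \<in> A" for m c
    using ideal_type_ringD(3)[OF I A[OF that], of "Poly_Mapping.single 0 c"] by (simp add: mult_single)
  then have "(\<Sum>m\<in>Poly_Mapping.keys f. Poly_Mapping.single m (Poly_Mapping.lookup f m)) \<in> I"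
    using f by (intro ideal_type_ring_sum[OF I]) (auto simp: supported_def)
  then show "f \<in> I" by (simp flip: poly_mapping_sum_single)
qed

definition multiples :: "'a::plus set \<Rightarrow> 'a set" where
  "multiples G = {l + g | l g. g \<in> G}"

lemma upset_multiples: "upset (multiples (G :: 'a::semigroup_add set))"
  by (auto simp: upset_def multiples_def) (metis add.assoc)

text \<open>Translates ideals given by generators into exponent sets, so that minimal generation
  becomes non-divisibility of monomials.\<close>

lemma genideal_monomials:
  fixes G :: "'a::comm_monoid_add set"
  shows "Idl\<^bsub>ring_of_type_algebra\<^esub> ((\<lambda>g. Poly_Mapping.single g 1) ` G) =
    (supported (multiples G) :: ('a \<Rightarrow>\<^sub>0 'b::comm_ring_1) set)" (is "Idl\<^bsub>_\<^esub> ?G = ?S")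
proof
  interpret cring "ring_of_type_algebra :: ('a \<Rightarrow>\<^sub>0 'b) ring" by (rule cring_from_type_algebra)
  have "g \<in> multiples G" if "g \<in> G" for g
    using that by (auto simp: multiples_def intro: exI[of _ 0] exI[of _ g])
  then show "Idl\<^bsub>ring_of_type_algebra\<^esub> ?G \<subseteq> ?S"
    by (intro genideal_minimal ideal_supported upset_multiples) auto
  have I: "ideal (Idl\<^bsub>ring_of_type_algebra\<^esub> ?G) ring_of_type_algebra"
    by (rule genideal_ideal) simp
  show "?S \<subseteq> Idl\<^bsub>ring_of_type_algebra\<^esub> ?G"
  proof (rule supported_subset_ideal[OF I])
    fix m assume "m \<in> multiples G"
    then obtain l g where m: "m = l + g" "g \<in> G" by (auto simp: multiples_def)
    have "?G \<subseteq> Idl\<^bsub>ring_of_type_algebra\<^esub> ?G" by (rule genideal_self) simp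
    then have "Poly_Mapping.single l 1 * Poly_Mapping.single g 1 \<in> Idl\<^bsub>ring_of_type_algebra\<^esub> ?G"
      using m by (intro ideal_type_ringD(3)[OF I]) auto
    then show "Poly_Mapping.single m 1 \<in> Idl\<^bsub>ring_of_type_algebra\<^esub> ?G"
      by (simp add: mult_single m)
  qed
qed

lemma monomial_divisible:
  fixes f :: "'a::cancel_comm_monoid_add \<Rightarrow>\<^sub>0 'b::comm_semiring_1"
  assumes "f \<in> supported (multiples {g})"
  obtains f' where "f = f' * Poly_Mapping.single g 1"
proof
  have "Poly_Mapping.single m c = Poly_Mapping.single (m - g) c * Poly_Mapping.single g 1"
    if m: "m \<in> Poly_Mapping.keys f" for m and c :: 'b
  proof -
    obtain l where "m = l + g" using m assms unfolding supported_def multiples_def by blast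
    then show ?thesis by (simp add: mult_single)
  qed
  then show "f = (\<Sum>m\<in>Poly_Mapping.keys f. Poly_Mapping.single (m - g) (Poly_Mapping.lookup f m)) * Poly_Mapping.single g 1"
    by (subst poly_mapping_sum_single[of f]) (simp add: sum_distrib_right)
qed

section \<open>Primes generated by variables\<close>

abbreviation e_var :: "'n \<Rightarrow> 'n \<Rightarrow>\<^sub>0 nat" where
  "e_var i \<equiv> Poly_Mapping.single i 1"

abbreviation var :: "'n \<Rightarrow> ('n \<Rightarrow>\<^sub>0 nat) \<Rightarrow>\<^sub>0 'k::zero_neq_one" where
  "var i \<equiv> Poly_Mapping.single (e_var i) 1"

definition free_of :: "'n set \<Rightarrow> ('n \<Rightarrow>\<^sub>0 nat) set" where
  "free_of V = {m. \<forall>i\<in>V. Poly_Mapping.lookup m i = 0}"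

text \<open>The ideal generated by the variables in \<open>V\<close>. Described by supports, it has
  the polynomials supported on \<open>free_of V\<close> as a complement, which represents the
  quotient ring.\<close>

definition var_ideal :: "'n set \<Rightarrow> (('n \<Rightarrow>\<^sub>0 nat) \<Rightarrow>\<^sub>0 'k::zero) set" where
  "var_ideal V = supported (- free_of V)"

lemma zero_in_free_of [simp]: "0 \<in> free_of V"
  by (simp add: free_of_def)

lemma add_in_free_of [simp]: "m + l \<in> free_of V \<longleftrightarrow> m \<in> free_of V \<and> l \<in> free_of V"
  by (auto simp: free_of_def lookup_add)

lemma ideal_var_ideal: "ideal (var_ideal V :: (('n \<Rightarrow>\<^sub>0 nat) \<Rightarrow>\<^sub>0 'k::comm_ring_1) set) ring_of_type_algebra"
  unfolding var_ideal_def by (rule ideal_supported) (auto simp: upset_def)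

lemma split_var_ideal:
  fixes f :: "('n \<Rightarrow>\<^sub>0 nat) \<Rightarrow>\<^sub>0 'k::comm_ring_1"
  obtains f0 f1 where "f = f0 + f1" "f0 \<in> supported (free_of V)" "f1 \<in> var_ideal V"
  using that[of "restr (free_of V) f" "restr (- free_of V) f"]
  by (simp add: restr_add_restr_Compl supported_def var_ideal_def)

lemma supported_free_of_mult:
  fixes f g :: "('n \<Rightarrow>\<^sub>0 nat) \<Rightarrow>\<^sub>0 'k::comm_ring_1"
  assumes "f \<in> supported (free_of V)" "g \<in> supported (free_of V)"
  shows "f * g \<in> supported (free_of V)"
  using assms by (rule supported_mult) auto

lemma supported_free_of_var_ideal:
  assumes "f \<in> supported (free_of V)" "f \<in> var_ideal V"
  shows "f = 0"
proof -
  have "Poly_Mapping.keys f = {}" using assms unfolding supported_def var_ideal_def by blast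
  then show ?thesis by simp
qed

text \<open>Modulo the ideal, \<open>a * b\<close> is the product \<open>a0 * b0\<close> of the
  parts free of \<open>V\<close>. That product is again free of \<open>V\<close>, so it lies in the
  ideal only if it is zero.\<close>

lemma prime_var_ideal:
  "primeideal (var_ideal V :: (('n::finite \<Rightarrow>\<^sub>0 nat) \<Rightarrow>\<^sub>0 'k::idom) set) ring_of_type_algebra"
  unfolding primeideal_type_ring_iff
proof (intro conjI allI impI ideal_var_ideal)
  show "1 \<notin> (var_ideal V :: (('n \<Rightarrow>\<^sub>0 nat) \<Rightarrow>\<^sub>0 'k) set)" by (simp add: var_ideal_def)
  fix a b :: "('n \<Rightarrow>\<^sub>0 nat) \<Rightarrow>\<^sub>0 'k"
  assume ab: "a * b \<in> var_ideal V"
  obtain a0 a1 where a: "a = a0 + a1" "a0 \<in> supported (free_of V)" "a1 \<in> var_ideal V" by (rule split_var_ideal)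
  obtain b0 b1 where b: "b = b0 + b1" "b0 \<in> supported (free_of V)" "b1 \<in> var_ideal V" by (rule split_var_ideal)
  note I = ideal_type_ringD[OF ideal_var_ideal[of V, where 'k = 'k]]
  have "a * b - (a0 * b1 + a1 * b) \<in> var_ideal V"
    by (rule I(6)[OF ab I(2)[OF I(3)[OF b(3)] I(4)[OF a(3)]]])
  then have "a0 * b0 \<in> var_ideal V" by (simp add: a b algebra_simps)
  then have "a0 * b0 = 0"
    using a b supported_free_of_mult supported_free_of_var_ideal by blast
  then show "a \<in> var_ideal V \<or> b \<in> var_ideal V"
    using a b by (auto simp: mpoly_mult_eq_0_iff)
qed

lemma var_in_var_ideal: "(var i :: ('n \<Rightarrow>\<^sub>0 nat) \<Rightarrow>\<^sub>0 'k::comm_ring_1) \<in> var_ideal V \<longleftrightarrow> i \<in> V"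
  by (auto simp: var_ideal_def free_of_def lookup_single when_def)

lemma var_ideal_empty [simp]: "var_ideal {} = {0}"
  by (simp add: var_ideal_def free_of_def)

lemma var_ideal_mono: "V \<subseteq> W \<Longrightarrow> var_ideal V \<subseteq> var_ideal W"
  unfolding var_ideal_def by (rule supported_mono) (auto simp: free_of_def)

lemma var_ideal_strict_mono:
  assumes "V \<subset> W"
  shows "(var_ideal V :: (('n \<Rightarrow>\<^sub>0 nat) \<Rightarrow>\<^sub>0 'k::comm_ring_1) set) \<subset> var_ideal W"
proof -
  obtain i where i: "i \<in> W" "i \<notin> V" using assms by blast
  then have "(var_ideal V :: (('n \<Rightarrow>\<^sub>0 nat) \<Rightarrow>\<^sub>0 'k) set) \<noteq> var_ideal W"
    using var_in_var_ideal by metis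
  then show ?thesis using var_ideal_mono[of V W] assms by blast
qed

lemma var_ideal_subset:
  fixes I :: "(('n \<Rightarrow>\<^sub>0 nat) \<Rightarrow>\<^sub>0 'k::comm_ring_1) set"
  assumes I: "ideal I ring_of_type_algebra" and V: "\<And>i. i \<in> V \<Longrightarrow> var i \<in> I"
  shows "var_ideal V \<subseteq> I"
  unfolding var_ideal_def
proof (rule supported_subset_ideal[OF I])
  fix m assume "m \<in> - free_of V"
  then obtain i where i: "i \<in> V" "Poly_Mapping.lookup m i \<noteq> 0" by (auto simp: free_of_def)
  have "m = (m - e_var i) + e_var i"
    by (rule poly_mapping_eqI) (use i in \<open>auto simp: lookup_add lookup_minus lookup_single when_def\<close>)
  then have "Poly_Mapping.single m 1 = Poly_Mapping.single (m - e_var i) (1::'k) * var i"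
    by (simp add: mult_single)
  then show "Poly_Mapping.single m 1 \<in> I"
    using ideal_type_ringD(3)[OF I V[OF i(1)]] by metis
qed

section \<open>Heights\<close>

lemma height_ge:
  assumes "\<And>i. i \<le> l \<Longrightarrow> primeideal (c i) R" "\<And>i. i < l \<Longrightarrow> c i \<subset> c (Suc i)" "c l = p"
  shows "enat l \<le> height R p"
  unfolding height_def by (rule Sup_upper) (use assms in blast)

lemma height_le:
  assumes "\<And>l c. (\<forall>i\<le>l. primeideal (c i) R) \<Longrightarrow> (\<forall>i<l. c i \<subset> c (Suc i)) \<Longrightarrow> c l = p \<Longrightarrow> l \<le> h"
  shows "height R p \<le> enat h"
  unfolding height_def by (rule Sup_least) (use assms in auto)

section \<open>Division with respect to one distinguished variable\<close>

abbreviation deg_less :: "'n \<Rightarrow> nat \<Rightarrow> (('n \<Rightarrow>\<^sub>0 nat) \<Rightarrow>\<^sub>0 'k::zero) set" where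
  "deg_less z N \<equiv> supported {m. Poly_Mapping.lookup m z < N}"

text \<open>Reads \<open>f\<close> as a polynomial in \<open>z\<close> over the other variables;
  \<open>b\<close> is its coefficient at \<open>z ^ D\<close> and may be zero. As
  \<open>deg_less\<close> is a strict bound, \<open>deg_less z 0\<close> is \<open>{0}\<close> and
  the zero polynomial needs no degree.\<close>

lemma leading_coeff_obtains:
  fixes f :: "('n \<Rightarrow>\<^sub>0 nat) \<Rightarrow>\<^sub>0 'k::comm_ring_1"
  assumes "f \<in> deg_less z (Suc D)"
  obtains b f' where "f = b * Poly_Mapping.single (Poly_Mapping.single z D) 1 + f'"
    "b \<in> supported (free_of {z})" "f' \<in> deg_less z D"
proof -
  let ?A = "{m. Poly_Mapping.lookup m z = D}" and ?z = "Poly_Mapping.single z D :: 'n \<Rightarrow>\<^sub>0 nat"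
  have "m = (m - ?z) + ?z" if "m \<in> ?A" for m
    by (rule poly_mapping_eqI) (use that in \<open>auto simp: lookup_add lookup_minus lookup_single when_def\<close>)
  then have "restr ?A f \<in> supported (multiples {?z})"
    by (fastforce simp: supported_def multiples_def)
  then obtain b where b: "restr ?A f = b * Poly_Mapping.single ?z 1" by (rule monomial_divisible)
  have "(\<lambda>l. l + ?z) ` Poly_Mapping.keys b \<subseteq> ?A"
    unfolding keys_mult_single[symmetric] b[symmetric] by simp
  then have "b \<in> supported (free_of {z})"
    by (auto simp: supported_def free_of_def lookup_add)
  moreover have "restr (- ?A) f \<in> deg_less z D"
    using assms by (auto simp: supported_def less_Suc_eq)
  ultimately show ?thesis
    using that restr_add_restr_Compl[of ?A f] b by metis
qed

lemma free_mult_deg_less: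
  fixes f b :: "('n \<Rightarrow>\<^sub>0 nat) \<Rightarrow>\<^sub>0 'k::comm_ring_1"
  shows "b \<in> supported (free_of {z}) \<Longrightarrow> f \<in> deg_less z N \<Longrightarrow> b * f \<in> deg_less z N"
  by (rule supported_mult) (auto simp: free_of_def lookup_add)

text \<open>The coefficient \<open>b\<close> need not be a unit, so each reduction of the leading
  term costs a factor \<open>b\<close>. The bound on the quotient \<open>q\<close> is what later
  makes it too small to be a nonzero element of the smaller prime.\<close>

lemma pseudo_division:
  fixes g :: "('n \<Rightarrow>\<^sub>0 nat) \<Rightarrow>\<^sub>0 'k::comm_ring_1"
  assumes g: "g = b * Poly_Mapping.single (Poly_Mapping.single z D) 1 + g'"
    and b: "b \<in> supported (free_of {z})" and g': "g' \<in> deg_less z D"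
  shows "h \<in> deg_less z N \<Longrightarrow>
    \<exists>k q r. b ^ k * h = q * g + r \<and> r \<in> deg_less z D \<and> q \<in> deg_less z (N - D)"
proof (induction N arbitrary: h)
  case 0
  then show ?case by (intro exI[of _ 0]) auto
next
  case (Suc M)
  show ?case
  proof (cases "M < D")
    case True
    then have "h \<in> deg_less z D"
      using Suc.prems by (auto simp: supported_def)
    then show ?thesis by (intro exI[of _ 0] exI[of _ h]) simp
  next
    case False
    let ?z = "\<lambda>n. Poly_Mapping.single (Poly_Mapping.single z n) (1::'k)"
    obtain c h' where h: "h = c * ?z M + h'" and c: "c \<in> supported (free_of {z})" and h': "h' \<in> deg_less z M"
      using Suc.prems by (rule leading_coeff_obtains)
    have z: "?z M = ?z (M - D) * ?z D"
      using False by (simp add: mult_single flip: single_add)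
    have cz: "c * ?z (M - D) \<in> deg_less z (Suc (M - D))"
      by (rule free_mult_deg_less[OF c]) simp
    have "?z (M - D) * g' \<in> deg_less z M"
      by (rule supported_mult[of _ "{m. Poly_Mapping.lookup m z \<le> M - D}", OF _ g']) (use False in \<open>auto simp: lookup_add\<close>)
    \<comment> \<open>This is \<open>b * h - c * z ^ (M - D) * g\<close> after the terms
      \<open>b * c * z ^ M\<close> have cancelled.\<close>
    then have "b * h' - c * (?z (M - D) * g') \<in> deg_less z M"
      by (intro supported_diff free_mult_deg_less[OF b h'] free_mult_deg_less[OF c])
    then obtain k q r where q: "b ^ k * (b * h' - c * (?z (M - D) * g')) = q * g + r" "r \<in> deg_less z D"
        "q \<in> deg_less z (M - D)"
      using Suc.IH by blast
    have "b ^ Suc k * h = b ^ k * c * ?z (M - D) * g + b ^ k * (b * h' - c * (?z (M - D) * g'))"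
      unfolding h g z by (simp add: algebra_simps)
    then have "b ^ Suc k * h = (b ^ k * (c * ?z (M - D)) + q) * g + r"
      using q(1) by (simp add: algebra_simps)
    moreover have "b ^ k \<in> supported (free_of {z})"
      by (induction k) (auto intro: supported_free_of_mult[OF b])
    then have "b ^ k * (c * ?z (M - D)) + q \<in> deg_less z (Suc M - D)"
    proof (rule supported_add[OF free_mult_deg_less])
      show "c * ?z (M - D) \<in> deg_less z (Suc M - D)"
        using cz False by (simp add: Suc_diff_le)
      show "q \<in> deg_less z (Suc M - D)"
        using q(3) by (auto simp: supported_def)
    qed
    ultimately show ?thesis using q(2) by blast
  qed
qed

text \<open>In \<open>B[z]\<close>, where \<open>B\<close> is a domain, no chain of three primes contracts to zero in \<open>B\<close>:
  an element of least \<open>z\<close>-degree of the largest prime generates it up to a nonzero factor in \<open>B\<close>.\<close>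

lemma prime_chain_eliminate:
  fixes P Q :: "(('n::finite \<Rightarrow>\<^sub>0 nat) \<Rightarrow>\<^sub>0 'k::idom) set"
  assumes P: "primeideal P ring_of_type_algebra" and Q: "primeideal Q ring_of_type_algebra"
    and PQ: "P \<subset> Q" and P0: "P \<noteq> {0}"
  obtains b where "b \<in> Q" "b \<noteq> 0" "b \<in> supported (free_of {z})"
proof (rule ccontr)
  note obt = that
  assume "\<not> thesis"
  then have free: "b = 0" if "b \<in> Q" "b \<in> supported (free_of {z})" for b
    using obt[of b] that by blast
  note IP = ideal_type_ringD[OF primeideal_type_ringD(1)[OF P]] and IQ = ideal_type_ringD[OF primeideal_type_ringD(1)[OF Q]]
  have bound: "\<exists>N. f \<in> deg_less z N" for f :: "('n \<Rightarrow>\<^sub>0 nat) \<Rightarrow>\<^sub>0 'k"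
    using finite_imageI[OF finite_keys, of "\<lambda>m. Poly_Mapping.lookup m z" f, THEN finite_nat_set_iff_bounded[THEN iffD1]]
    by (auto simp: supported_def subset_iff)
  have least: "\<exists>f D. f \<in> I \<and> f \<noteq> 0 \<and> f \<in> deg_less z (Suc D) \<and> (\<forall>g. g \<in> I \<and> g \<in> deg_less z D \<longrightarrow> g = 0)"
    if I: "f0 \<in> I" "f0 \<noteq> 0" for I and f0 :: "('n \<Rightarrow>\<^sub>0 nat) \<Rightarrow>\<^sub>0 'k"
  proof -
    let ?P = "\<lambda>N. \<exists>f\<in>I. f \<noteq> 0 \<and> f \<in> deg_less z N"
    have "\<exists>N. ?P N" using bound[of f0] I by blast
    then have ex: "?P (LEAST N. ?P N)" by (rule LeastI_ex)
    moreover have "\<not> ?P 0" by simp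
    ultimately have "(LEAST N. ?P N) \<noteq> 0" by metis
    then obtain D where D: "(LEAST N. ?P N) = Suc D" using not0_implies_Suc by blast
    have "\<not> ?P D" by (rule not_less_Least) (simp add: D)
    moreover have "?P (Suc D)" using ex unfolding D .
    ultimately show ?thesis by blast
  qed
  obtain f0 where f0: "f0 \<in> P" "f0 \<noteq> 0" using P0 IP(1) by blast
  then have f0Q: "f0 \<in> Q" using PQ by blast
  obtain f D1 where f: "f \<in> P" "f \<noteq> 0" "f \<in> deg_less z (Suc D1)"
      "\<And>h. h \<in> P \<Longrightarrow> h \<in> deg_less z D1 \<Longrightarrow> h = 0"
    using least[OF f0] by (elim exE conjE) metis
  obtain g D2 where g: "g \<in> Q" "g \<noteq> 0" "g \<in> deg_less z (Suc D2)"
      "\<And>h. h \<in> Q \<Longrightarrow> h \<in> deg_less z D2 \<Longrightarrow> h = 0"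
    using least[OF f0Q f0(2)] by (elim exE conjE) metis
  \<comment> \<open>For \<open>D2 = 0\<close> the element \<open>g\<close> itself would be free of
    \<open>z\<close>.\<close>
  have D2: "D2 > 0"
  proof (rule ccontr)
    assume "\<not> D2 > 0"
    then have "g \<in> supported (free_of {z})" using g(3) by (simp add: supported_def free_of_def)
    then show False using free g by blast
  qed
  obtain b g' where b: "g = b * Poly_Mapping.single (Poly_Mapping.single z D2) 1 + g'"
      "b \<in> supported (free_of {z})" "g' \<in> deg_less z D2"
    using g(3) by (rule leading_coeff_obtains)
  have b0: "b \<noteq> 0" using b g by auto
  \<comment> \<open>A power of \<open>b\<close> in \<open>P\<close> would put \<open>b\<close>, a
    nonzero element free of \<open>z\<close>, into \<open>Q\<close>.\<close>
  have bP: "b ^ k \<notin> P" for k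
    using b0 free[OF _ b(2)] primeideal_type_ringD(4)[OF P, of b k] PQ by blast
  \<comment> \<open>The remainder lies in \<open>Q\<close> and has smaller degree in
    \<open>z\<close> than the least possible, so it vanishes.\<close>
  have div: "\<exists>k q. b ^ k * h = q * g \<and> q \<in> deg_less z (N - D2)" if h: "h \<in> Q" "h \<in> deg_less z N" for h N
  proof -
    obtain k q r where q: "b ^ k * h = q * g + r" "r \<in> deg_less z D2" "q \<in> deg_less z (N - D2)"
      using pseudo_division[OF b h(2)] by blast
    have "b ^ k * h - q * g \<in> Q" using h g by (intro IQ(3,6))
    then have "r \<in> Q" using q by (simp add: algebra_simps)
    then have "r = 0" using g q by blast
    then show ?thesis using q by auto
  qed
  \<comment> \<open>Divide the least element of \<open>P\<close> by that of \<open>Q\<close>: then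
    \<open>q\<close> or \<open>g\<close> lies in \<open>P\<close>. As \<open>D2 > 0\<close>,
    \<open>q\<close> has smaller degree in \<open>z\<close> than \<open>f\<close> and would vanish;
    with \<open>g\<close> in \<open>P\<close>, all of \<open>Q\<close> would follow, since powers of
    \<open>b\<close> can be cancelled modulo \<open>P\<close>.\<close>
  obtain k q where q: "b ^ k * f = q * g" "q \<in> deg_less z (Suc D1 - D2)"
    using div[of f] f PQ by blast
  have "b ^ k * f \<in> P" using f by (intro IP(3))
  then consider "q \<in> P" | "g \<in> P" using q primeideal_type_ringD(3)[OF P] by metis
  then show False
  proof cases
    case 1
    have "deg_less z (Suc D1 - D2) \<subseteq> (deg_less z D1 :: (('n \<Rightarrow>\<^sub>0 nat) \<Rightarrow>\<^sub>0 'k) set)"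
      using D2 by (intro supported_mono) auto
    then have "q = 0" using 1 f(4) q by blast
    then show False using q f(2) b0 by (simp add: mpoly_mult_eq_0_iff mpoly_power_eq_0_iff)
  next
    case 2
    have "Q \<subseteq> P"
    proof
      fix h assume h: "h \<in> Q"
      obtain N where "h \<in> deg_less z N" using bound by blast
      then obtain k q where "b ^ k * h = q * g" using div h by blast
      then have "b ^ k * h \<in> P" using 2 IP(3) by metis
      then show "h \<in> P" using bP primeideal_type_ringD(3)[OF P] by blast
    qed
    then show False using PQ by blast
  qed
qed

text \<open>Every term of \<open>b\<close> lies in \<open>(x, z)\<close> and is free of
  \<open>z\<close>, so \<open>b\<close> is divisible by \<open>x\<close>. If \<open>x\<close> were
  not in \<open>Q\<close>, cancelling it would leave an element of the same kind with smaller degree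
  in \<open>x\<close>, which cannot go on forever.\<close>

lemma var_in_prime:
  fixes Q :: "(('n::finite \<Rightarrow>\<^sub>0 nat) \<Rightarrow>\<^sub>0 'k::idom) set"
  assumes Q: "primeideal Q ring_of_type_algebra" and sub: "Q \<subseteq> var_ideal {x, z}"
    and b: "b \<in> Q" "b \<noteq> 0" "b \<in> supported (free_of {z})"
  shows "var x \<in> Q"
proof -
  have "var x \<in> Q" if "b \<in> Q" "b \<noteq> 0" "b \<in> supported (free_of {z})" "b \<in> deg_less x N" for b N
    using that
  proof (induction N arbitrary: b)
    case (Suc N)
    have "m = (m - e_var x) + e_var x" if "m \<in> Poly_Mapping.keys b" for m
      by (rule poly_mapping_eqI)
         (use that sub Suc.prems in \<open>fastforce simp: supported_def var_ideal_def free_of_def lookup_add lookup_minus lookup_single when_def\<close>)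
    then have "b \<in> supported (multiples {e_var x})"
      by (fastforce simp: supported_def multiples_def)
    then obtain c where c: "b = c * var x" by (rule monomial_divisible)
    then have k: "(\<lambda>l. l + e_var x) ` Poly_Mapping.keys c = Poly_Mapping.keys b"
      by (simp add: keys_mult_single)
    show ?case
    proof (rule ccontr)
      assume x: "var x \<notin> Q"
      then have "c \<in> Q" using Suc.prems(1) c primeideal_type_ringD(3)[OF Q] by blast
      moreover have "c \<noteq> 0" using c Suc.prems by auto
      moreover have "c \<in> supported (free_of {z})" "c \<in> deg_less x N"
        using Suc.prems(3,4) by (auto simp: supported_def free_of_def lookup_add simp flip: k)
      ultimately show False using x Suc.IH by blast
    qed
  qed simp
  moreover have "\<exists>N. b \<in> deg_less x N"
    using finite_imageI[OF finite_keys, of "\<lambda>m. Poly_Mapping.lookup m x" b, THEN finite_nat_set_iff_bounded[THEN iffD1]]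
    by (auto simp: supported_def subset_iff)
  ultimately show ?thesis using b by blast
qed

text \<open>In a longer chain only the last four primes matter. The lowest of them makes the next
  one nonzero; eliminating \<open>z\<close> and then \<open>x\<close> puts both variables into the
  third, which therefore already equals \<open>(x, z)\<close>. The chain \<open>0\<close>,
  \<open>(x)\<close>, \<open>(x, z)\<close> gives the other inequality.\<close>

lemma height_var_ideal_2:
  fixes x z :: "'n::finite"
  assumes xz: "x \<noteq> z"
  shows "height ring_of_type_algebra (var_ideal {x, z} :: (('n \<Rightarrow>\<^sub>0 nat) \<Rightarrow>\<^sub>0 'k::idom) set) = 2"
proof (rule antisym)
  show "height ring_of_type_algebra (var_ideal {x, z} :: (('n \<Rightarrow>\<^sub>0 nat) \<Rightarrow>\<^sub>0 'k) set) \<le> 2"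
    unfolding numeral_eq_enat
  proof (rule height_le, rule ccontr)
    fix l and c :: "nat \<Rightarrow> (('n \<Rightarrow>\<^sub>0 nat) \<Rightarrow>\<^sub>0 'k) set"
    assume c: "\<forall>i\<le>l. primeideal (c i) ring_of_type_algebra" "\<forall>i<l. c i \<subset> c (Suc i)"
      "c l = var_ideal {x, z}" and "\<not> l \<le> 2"
    then obtain k where k: "l = Suc (Suc (Suc k))"
      by (metis Suc_le_D not_less_eq_eq numeral_2_eq_2)
    have p: "primeideal (c k) ring_of_type_algebra" "primeideal (c (Suc k)) ring_of_type_algebra"
        "primeideal (c (Suc (Suc k))) ring_of_type_algebra"
      and s: "c k \<subset> c (Suc k)" "c (Suc k) \<subset> c (Suc (Suc k))" "c (Suc (Suc k)) \<subset> var_ideal {x, z}"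
      using c k by auto
    have "0 \<in> c k" using p(1) by (intro ideal_type_ringD primeideal_type_ringD)
    then have "c (Suc k) \<noteq> {0}" using s(1) by auto
    note el = prime_chain_eliminate[OF p(2,3) s(2) this]
    obtain b where "b \<in> c (Suc (Suc k))" "b \<noteq> 0" "b \<in> supported (free_of {z})" by (rule el)
    then have "var x \<in> c (Suc (Suc k))" using var_in_prime[OF p(3)] s(3) by blast
    moreover obtain b where "b \<in> c (Suc (Suc k))" "b \<noteq> 0" "b \<in> supported (free_of {x})" by (rule el)
    then have "var z \<in> c (Suc (Suc k))"
      using var_in_prime[OF p(3), of z x] s(3) by (simp add: insert_commute)
    ultimately have "var_ideal {x, z} \<subseteq> c (Suc (Suc k))"
      by (intro var_ideal_subset primeideal_type_ringD(1)[OF p(3)]) auto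
    then show False using s by blast
  qed
  define c :: "nat \<Rightarrow> (('n \<Rightarrow>\<^sub>0 nat) \<Rightarrow>\<^sub>0 'k) set"
    where "c i = var_ideal (if i = 0 then {} else if i = 1 then {x} else {x, z})" for i
  have "enat 2 \<le> height ring_of_type_algebra (var_ideal {x, z} :: (('n \<Rightarrow>\<^sub>0 nat) \<Rightarrow>\<^sub>0 'k) set)"
  proof (rule height_ge[of _ c])
    fix i :: nat assume "i < 2"
    then have "i = 0 \<or> i = 1" by auto
    then show "c i \<subset> c (Suc i)"
      unfolding c_def by (intro var_ideal_strict_mono) (use xz in auto)
  next
    fix i :: nat
    show "primeideal (c i) ring_of_type_algebra"
      unfolding c_def by (rule prime_var_ideal)
  qed (simp add: c_def)
  then show "2 \<le> height ring_of_type_algebra (var_ideal {x, z} :: (('n \<Rightarrow>\<^sub>0 nat) \<Rightarrow>\<^sub>0 'k) set)"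
    by (simp only: numeral_eq_enat)
qed

text \<open>Extends the chain \<open>0\<close>, \<open>(x)\<close>, \<open>(x, z)\<close> by
  \<open>p\<close>. Thus \<open>(x, z)\<close> is the only candidate among the associated primes
  containing both variables.\<close>

lemma height_gt_2:
  fixes x z :: "'n::finite" and p :: "(('n \<Rightarrow>\<^sub>0 nat) \<Rightarrow>\<^sub>0 'k::idom) set"
  assumes xz: "x \<noteq> z" and p: "primeideal p ring_of_type_algebra" and sub: "var_ideal {x, z} \<subset> p"
  shows "height ring_of_type_algebra p \<noteq> 2"
proof -
  define c where "c i = [var_ideal {}, var_ideal {x}, var_ideal {x, z}, p] ! i" for i
  have c: "c 0 = var_ideal {}" "c 1 = var_ideal {x}" "c 2 = var_ideal {x, z}" "c 3 = p"
    unfolding c_def by (simp_all add: numeral_2_eq_2 numeral_3_eq_3 del: var_ideal_empty)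
  have "enat 3 \<le> height ring_of_type_algebra p"
  proof (rule height_ge[of _ c])
    fix i :: nat assume "i \<le> 3"
    then have "i = 0 \<or> i = 1 \<or> i = 2 \<or> i = 3" by auto
    then show "primeideal (c i) ring_of_type_algebra"
      by (elim disjE) (simp_all only: c p prime_var_ideal)
  next
    fix i :: nat assume "i < 3"
    then have "i = 0 \<and> Suc i = 1 \<or> i = 1 \<and> Suc i = 2 \<or> i = 2 \<and> Suc i = 3" by auto
    moreover have "c 0 \<subset> c 1" "c 1 \<subset> c 2"
      unfolding c by (intro var_ideal_strict_mono; use xz in auto)+
    moreover have "c 2 \<subset> c 3" using sub unfolding c .
    ultimately show "c i \<subset> c (Suc i)" by (elim disjE conjE) (simp_all only:)
  qed (rule c)
  moreover have "\<not> enat 3 \<le> enat 2" by simp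
  ultimately show ?thesis by (auto simp only: numeral_eq_enat)
qed

section \<open>Quotient rings\<close>

locale ideal_of_type =
  fixes J :: "'a::comm_ring_1 set"
  assumes J: "ideal J ring_of_type_algebra"
begin

abbreviation R :: "'a ring" where "R \<equiv> ring_of_type_algebra"
abbreviation Q :: "'a set ring" where "Q \<equiv> R Quot J"

lemmas J_simps = ideal_type_ringD[OF J]

lemma Q_simps:
  "carrier Q = range (\<lambda>r. J +>\<^bsub>R\<^esub> r)"
  "(J +>\<^bsub>R\<^esub> a) \<otimes>\<^bsub>Q\<^esub> (J +>\<^bsub>R\<^esub> b) = J +>\<^bsub>R\<^esub> (a * b)"
  "(J +>\<^bsub>R\<^esub> a) \<oplus>\<^bsub>Q\<^esub> (J +>\<^bsub>R\<^esub> b) = J +>\<^bsub>R\<^esub> (a + b)"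
  "(J +>\<^bsub>R\<^esub> a) \<ominus>\<^bsub>Q\<^esub> (J +>\<^bsub>R\<^esub> b) = J +>\<^bsub>R\<^esub> (a - b)"
  "\<one>\<^bsub>Q\<^esub> = J +>\<^bsub>R\<^esub> 1"
  "\<zero>\<^bsub>Q\<^esub> = J +>\<^bsub>R\<^esub> 0"
proof -
  interpret ideal J R by (rule J)
  interpret h: ring_hom_ring R Q "(+>\<^bsub>R\<^esub>) J" by (rule rcos_ring_hom_ring)
  show "carrier Q = range (\<lambda>r. J +>\<^bsub>R\<^esub> r)"
    by (auto simp: FactRing_def A_RCOSETS_def')
  show m: "(J +>\<^bsub>R\<^esub> a) \<otimes>\<^bsub>Q\<^esub> (J +>\<^bsub>R\<^esub> b) = J +>\<^bsub>R\<^esub> (a * b)" for a b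
    using h.hom_mult[of a b] by simp
  show "(J +>\<^bsub>R\<^esub> a) \<oplus>\<^bsub>Q\<^esub> (J +>\<^bsub>R\<^esub> b) = J +>\<^bsub>R\<^esub> (a + b)" for a b
    using h.hom_add[of a b] by simp
  then show "(J +>\<^bsub>R\<^esub> a) \<ominus>\<^bsub>Q\<^esub> (J +>\<^bsub>R\<^esub> b) = J +>\<^bsub>R\<^esub> (a - b)" for a b
    using h.hom_a_inv[of b] by (simp add: a_minus_def flip: h.hom_a_inv)
  show "\<one>\<^bsub>Q\<^esub> = J +>\<^bsub>R\<^esub> 1" using h.hom_one by simp
  show "\<zero>\<^bsub>Q\<^esub> = J +>\<^bsub>R\<^esub> 0" using h.hom_zero by simp
qed

lemma coset_eq_iff: "J +>\<^bsub>R\<^esub> a = J +>\<^bsub>R\<^esub> b \<longleftrightarrow> a - b \<in> J"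
proof -
  have c: "J +>\<^bsub>R\<^esub> x = {t. t - x \<in> J}" for x
    by (auto simp: a_r_coset_def' image_iff algebra_simps intro: bexI[of _ "_ - x"])
  show ?thesis
  proof
    assume "J +>\<^bsub>R\<^esub> a = J +>\<^bsub>R\<^esub> b"
    moreover have "a \<in> J +>\<^bsub>R\<^esub> a" by (simp add: c J_simps)
    ultimately show "a - b \<in> J" by (simp add: c)
  next
    assume ab: "a - b \<in> J"
    have "t - a \<in> J \<longleftrightarrow> t - b \<in> J" for t
      using J_simps(2)[OF _ ab, of "t - a"] J_simps(6)[OF _ ab, of "t - b"] by (auto simp: algebra_simps)
    then show "J +>\<^bsub>R\<^esub> a = J +>\<^bsub>R\<^esub> b" by (simp add: c)
  qed
qed

end

section \<open>Length of a localized quotient\<close>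

locale localized_quotient = ideal_of_type J for J :: "'a::comm_ring_1 set" +
  fixes p :: "'a set"
  assumes p: "primeideal p ring_of_type_algebra"
begin

abbreviation S :: "'a set set" where "S \<equiv> (\<lambda>s. J +>\<^bsub>R\<^esub> s) ` (UNIV - p)"
abbreviation L :: "('a set \<times> 'a set) set ring" where "L \<equiv> quot_localized R J p"

text \<open>The fraction \<open>r / s\<close> written with representatives in \<open>R\<close>;
  equality of fractions then becomes membership in \<open>J\<close>.\<close>

definition Cl :: "'a \<Rightarrow> 'a \<Rightarrow> ('a set \<times> 'a set) set" where
  "Cl r s = frac_rel Q S `` {(J +>\<^bsub>R\<^esub> r, J +>\<^bsub>R\<^esub> s)}"

lemma not_p: "1 \<notin> p" "s \<notin> p \<Longrightarrow> t \<notin> p \<Longrightarrow> s * t \<notin> p"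
  using primeideal_type_ringD[OF p] by blast+

lemma frac_rel_iff:
  assumes "s \<notin> p" "t \<notin> p"
  shows "((J +>\<^bsub>R\<^esub> a, J +>\<^bsub>R\<^esub> s), (J +>\<^bsub>R\<^esub> b, J +>\<^bsub>R\<^esub> t)) \<in> frac_rel Q S \<longleftrightarrow>
    (\<exists>u. u \<notin> p \<and> u * (t * a - s * b) \<in> J)"
proof -
  have "((J +>\<^bsub>R\<^esub> a, J +>\<^bsub>R\<^esub> s), (J +>\<^bsub>R\<^esub> b, J +>\<^bsub>R\<^esub> t)) \<in> frac_rel Q S \<longleftrightarrow>
    (\<exists>u. u \<notin> p \<and> J +>\<^bsub>R\<^esub> (u * (t * a - s * b)) = J +>\<^bsub>R\<^esub> 0)"
    using assms unfolding frac_rel_def by (auto simp: Q_simps)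
  then show ?thesis unfolding coset_eq_iff by simp
qed

lemma frac_rel_dest:
  assumes "(x, y) \<in> frac_rel Q S"
  obtains a s b t where "x = (J +>\<^bsub>R\<^esub> a, J +>\<^bsub>R\<^esub> s)" "y = (J +>\<^bsub>R\<^esub> b, J +>\<^bsub>R\<^esub> t)" "s \<notin> p" "t \<notin> p"
  using assms unfolding frac_rel_def Q_simps by auto

lemma equiv_frac_rel: "equiv (carrier Q \<times> S) (frac_rel Q S)"
proof (rule equivI)
  show "frac_rel Q S \<subseteq> (carrier Q \<times> S) \<times> (carrier Q \<times> S)"
    unfolding frac_rel_def by blast
  show "refl_on (carrier Q \<times> S) (frac_rel Q S)"
  proof (rule refl_onI)
    fix x assume "x \<in> carrier Q \<times> S"
    then obtain a s where x: "x = (J +>\<^bsub>R\<^esub> a, J +>\<^bsub>R\<^esub> s)" "s \<notin> p" unfolding Q_simps by auto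
    then show "(x, x) \<in> frac_rel Q S"
      using not_p(1) by (auto simp: frac_rel_iff J_simps(1))
  qed
  show "sym (frac_rel Q S)"
  proof (rule symI)
    fix x y assume xy: "(x, y) \<in> frac_rel Q S"
    then obtain a s b t where x: "x = (J +>\<^bsub>R\<^esub> a, J +>\<^bsub>R\<^esub> s)" "y = (J +>\<^bsub>R\<^esub> b, J +>\<^bsub>R\<^esub> t)" "s \<notin> p" "t \<notin> p"
      by (rule frac_rel_dest)
    then obtain u where u: "u \<notin> p" "u * (t * a - s * b) \<in> J" using xy by (auto simp: frac_rel_iff)
    have "u * (s * b - t * a) \<in> J" using J_simps(5)[OF u(2)] by (simp add: algebra_simps)
    then show "(y, x) \<in> frac_rel Q S" using u(1) x by (auto simp: frac_rel_iff)
  qed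
  show "trans (frac_rel Q S)"
  proof (rule transI)
    fix x y z assume xy: "(x, y) \<in> frac_rel Q S" and yz: "(y, z) \<in> frac_rel Q S"
    obtain a s b t where x: "x = (J +>\<^bsub>R\<^esub> a, J +>\<^bsub>R\<^esub> s)" "y = (J +>\<^bsub>R\<^esub> b, J +>\<^bsub>R\<^esub> t)" "s \<notin> p" "t \<notin> p"
      using xy by (rule frac_rel_dest)
    obtain c q where z: "z = (J +>\<^bsub>R\<^esub> c, J +>\<^bsub>R\<^esub> q)" "q \<notin> p" using yz by (rule frac_rel_dest)
    obtain u where u: "u \<notin> p" "u * (t * a - s * b) \<in> J" using xy x by (auto simp: frac_rel_iff)
    obtain v where v: "v \<notin> p" "v * (q * b - t * c) \<in> J" using yz x z by (auto simp: frac_rel_iff)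
    \<comment> \<open>The factor \<open>t\<close> clears the denominator of the middle fraction,
      which does not occur in the relation to be shown.\<close>
    have "(u * v * t) * (q * a - s * c) = (v * q) * (u * (t * a - s * b)) + (u * s) * (v * (q * b - t * c))"
      by (simp add: algebra_simps)
    then have "(u * v * t) * (q * a - s * c) \<in> J"
      using J_simps(2)[OF J_simps(3)[OF u(2)] J_simps(3)[OF v(2)]] by metis
    moreover have "u * v * t \<notin> p" using u v x not_p by simp
    ultimately show "(x, z) \<in> frac_rel Q S" using x z by (auto simp: frac_rel_iff)
  qed
qed

lemma Cl_eq_iff:
  assumes "s \<notin> p" "t \<notin> p"
  shows "Cl a s = Cl b t \<longleftrightarrow> (\<exists>u. u \<notin> p \<and> u * (t * a - s * b) \<in> J)"
  unfolding Cl_def frac_rel_iff[OF assms, symmetric]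
  by (rule eq_equiv_class_iff[OF equiv_frac_rel]) (use assms in \<open>auto simp: Q_simps\<close>)

lemma Cl_eqI: "s \<notin> p \<Longrightarrow> t \<notin> p \<Longrightarrow> t * a = s * b \<Longrightarrow> Cl a s = Cl b t"
  using not_p by (auto simp: Cl_eq_iff J_simps intro: exI[of _ 1])

lemma carrier_L: "carrier L = {Cl a s | a s. s \<notin> p}"
  unfolding quot_localized_def localization_def Cl_def by (auto simp: quotient_def Q_simps)

lemma Cl_mem:
  assumes "s \<notin> p" "(x, y) \<in> Cl a s"
  obtains b t where "x = J +>\<^bsub>R\<^esub> b" "y = J +>\<^bsub>R\<^esub> t" "t \<notin> p" "Cl a s = Cl b t"
proof -
  have r: "((J +>\<^bsub>R\<^esub> a, J +>\<^bsub>R\<^esub> s), (x, y)) \<in> frac_rel Q S" using assms by (simp add: Cl_def)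
  then obtain b t where bt: "x = J +>\<^bsub>R\<^esub> b" "y = J +>\<^bsub>R\<^esub> t" "t \<notin> p"
    by (rule frac_rel_dest) auto
  then have "Cl a s = Cl b t"
    using equiv_class_eq[OF equiv_frac_rel r] by (simp add: Cl_def)
  with bt show ?thesis by (rule that)
qed

lemma Cl_self: "s \<notin> p \<Longrightarrow> (J +>\<^bsub>R\<^esub> a, J +>\<^bsub>R\<^esub> s) \<in> Cl a s"
  unfolding Cl_def by (rule equiv_class_self[OF equiv_frac_rel]) (auto simp: Q_simps)

text \<open>The operations of the localization are unions over all representatives. Once the value
  is independent of them, the union is over copies of one set, and it is nonempty because each class
  contains its own representative.\<close>

lemma UN_Cl:
  assumes "s \<notin> p" "t \<notin> p"
    and "\<And>a' s' b' t'. s' \<notin> p \<Longrightarrow> t' \<notin> p \<Longrightarrow> Cl a s = Cl a' s' \<Longrightarrow> Cl b t = Cl b' t' \<Longrightarrow>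
      F (J +>\<^bsub>R\<^esub> a') (J +>\<^bsub>R\<^esub> s') (J +>\<^bsub>R\<^esub> b') (J +>\<^bsub>R\<^esub> t') = C"
  shows "(\<Union>(x, y)\<in>Cl a s. \<Union>(x', y')\<in>Cl b t. F x y x' y') = C"
proof -
  have "F x y x' y' = C" if xy: "(x, y) \<in> Cl a s" and xy': "(x', y') \<in> Cl b t" for x y x' y'
  proof -
    obtain a' s' where "x = J +>\<^bsub>R\<^esub> a'" "y = J +>\<^bsub>R\<^esub> s'" "s' \<notin> p" "Cl a s = Cl a' s'"
      by (rule Cl_mem[OF assms(1) xy])
    moreover obtain b' t' where "x' = J +>\<^bsub>R\<^esub> b'" "y' = J +>\<^bsub>R\<^esub> t'" "t' \<notin> p" "Cl b t = Cl b' t'"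
      by (rule Cl_mem[OF assms(2) xy'])
    ultimately show ?thesis using assms(3) by blast
  qed
  then show ?thesis
    using Cl_self[OF assms(1), of a] Cl_self[OF assms(2), of b] by fastforce
qed

lemma L_mult:
  assumes st: "s \<notin> p" "t \<notin> p"
  shows "Cl a s \<otimes>\<^bsub>L\<^esub> Cl b t = Cl (a * b) (s * t)"
proof -
  have "(\<Union>(x, y)\<in>Cl a s. \<Union>(x', y')\<in>Cl b t. frac_rel Q S `` {(x \<otimes>\<^bsub>Q\<^esub> x', y \<otimes>\<^bsub>Q\<^esub> y')}) = Cl (a * b) (s * t)"
  proof (rule UN_Cl[OF st])
    fix a' s' b' t' assume st': "s' \<notin> p" "t' \<notin> p" and eq: "Cl a s = Cl a' s'" "Cl b t = Cl b' t'"
    obtain u where u: "u \<notin> p" "u * (s' * a - s * a') \<in> J" using eq st st' by (auto simp: Cl_eq_iff)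
    obtain v where v: "v \<notin> p" "v * (t' * b - t * b') \<in> J" using eq st st' by (auto simp: Cl_eq_iff)
    have "(u * v) * ((s' * t') * (a * b) - (s * t) * (a' * b')) =
      (v * t' * b) * (u * (s' * a - s * a')) + (u * s * a') * (v * (t' * b - t * b'))"
      by (simp add: algebra_simps)
    then have "(u * v) * ((s' * t') * (a * b) - (s * t) * (a' * b')) \<in> J"
      using J_simps(2)[OF J_simps(3)[OF u(2)] J_simps(3)[OF v(2)]] by metis
    then have "Cl (a * b) (s * t) = Cl (a' * b') (s' * t')"
      using st st' u v not_p by (subst Cl_eq_iff) auto
    then show "frac_rel Q S `` {((J +>\<^bsub>R\<^esub> a') \<otimes>\<^bsub>Q\<^esub> (J +>\<^bsub>R\<^esub> b'), (J +>\<^bsub>R\<^esub> s') \<otimes>\<^bsub>Q\<^esub> (J +>\<^bsub>R\<^esub> t'))} = Cl (a * b) (s * t)"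
      by (simp add: Q_simps Cl_def)
  qed
  then show ?thesis by (simp add: quot_localized_def localization_def)
qed

lemma L_add:
  assumes st: "s \<notin> p" "t \<notin> p"
  shows "Cl a s \<oplus>\<^bsub>L\<^esub> Cl b t = Cl (a * t + b * s) (s * t)"
proof -
  have "(\<Union>(x, y)\<in>Cl a s. \<Union>(x', y')\<in>Cl b t. frac_rel Q S `` {(x \<otimes>\<^bsub>Q\<^esub> y' \<oplus>\<^bsub>Q\<^esub> x' \<otimes>\<^bsub>Q\<^esub> y, y \<otimes>\<^bsub>Q\<^esub> y')}) =
    Cl (a * t + b * s) (s * t)"
  proof (rule UN_Cl[OF st])
    fix a' s' b' t' assume st': "s' \<notin> p" "t' \<notin> p" and eq: "Cl a s = Cl a' s'" "Cl b t = Cl b' t'"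
    obtain u where u: "u \<notin> p" "u * (s' * a - s * a') \<in> J" using eq st st' by (auto simp: Cl_eq_iff)
    obtain v where v: "v \<notin> p" "v * (t' * b - t * b') \<in> J" using eq st st' by (auto simp: Cl_eq_iff)
    have "(u * v) * ((s' * t') * (a * t + b * s) - (s * t) * (a' * t' + b' * s')) =
      (v * t * t') * (u * (s' * a - s * a')) + (u * s * s') * (v * (t' * b - t * b'))"
      by (simp add: algebra_simps)
    then have "(u * v) * ((s' * t') * (a * t + b * s) - (s * t) * (a' * t' + b' * s')) \<in> J"
      using J_simps(2)[OF J_simps(3)[OF u(2)] J_simps(3)[OF v(2)]] by metis
    then have "Cl (a * t + b * s) (s * t) = Cl (a' * t' + b' * s') (s' * t')"
      using st st' u v not_p by (subst Cl_eq_iff) auto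
    then show "frac_rel Q S `` {((J +>\<^bsub>R\<^esub> a') \<otimes>\<^bsub>Q\<^esub> (J +>\<^bsub>R\<^esub> t') \<oplus>\<^bsub>Q\<^esub> (J +>\<^bsub>R\<^esub> b') \<otimes>\<^bsub>Q\<^esub> (J +>\<^bsub>R\<^esub> s'),
        (J +>\<^bsub>R\<^esub> s') \<otimes>\<^bsub>Q\<^esub> (J +>\<^bsub>R\<^esub> t'))} = Cl (a * t + b * s) (s * t)"
      by (simp add: Q_simps Cl_def)
  qed
  then show ?thesis by (simp add: quot_localized_def localization_def)
qed

lemma L_one: "\<one>\<^bsub>L\<^esub> = Cl 1 1" and L_zero: "\<zero>\<^bsub>L\<^esub> = Cl 0 1"
  by (simp_all add: quot_localized_def localization_def Cl_def Q_simps)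

lemma L_cases:
  assumes "x \<in> carrier L"
  obtains a s where "x = Cl a s" "s \<notin> p"
  using assms by (auto simp: carrier_L)

lemma Cl_closed: "s \<notin> p \<Longrightarrow> Cl a s \<in> carrier L"
  by (auto simp: carrier_L)

lemma ring_L: "ring L"
proof (rule ringI)
  show "abelian_group L"
  proof (rule abelian_groupI)
    fix x y assume "x \<in> carrier L" "y \<in> carrier L"
    then show "x \<oplus>\<^bsub>L\<^esub> y \<in> carrier L" "x \<oplus>\<^bsub>L\<^esub> y = y \<oplus>\<^bsub>L\<^esub> x"
      by (elim L_cases; simp add: L_add Cl_closed not_p algebra_simps)+
  next
    fix x y z assume "x \<in> carrier L" "y \<in> carrier L" "z \<in> carrier L"
    then show "(x \<oplus>\<^bsub>L\<^esub> y) \<oplus>\<^bsub>L\<^esub> z = x \<oplus>\<^bsub>L\<^esub> (y \<oplus>\<^bsub>L\<^esub> z)"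
      by (elim L_cases) (simp add: L_add not_p algebra_simps)
  next
    show "\<zero>\<^bsub>L\<^esub> \<in> carrier L" by (simp add: L_zero Cl_closed not_p)
    fix x assume "x \<in> carrier L"
    then obtain a s where x: "x = Cl a s" "s \<notin> p" by (rule L_cases)
    then show "\<zero>\<^bsub>L\<^esub> \<oplus>\<^bsub>L\<^esub> x = x" by (simp add: L_zero L_add not_p)
    have "Cl (- a) s \<oplus>\<^bsub>L\<^esub> x = \<zero>\<^bsub>L\<^esub>"
      using x by (simp add: L_zero L_add not_p) (rule Cl_eqI; simp add: not_p)
    then show "\<exists>y\<in>carrier L. y \<oplus>\<^bsub>L\<^esub> x = \<zero>\<^bsub>L\<^esub>" using Cl_closed x(2) by blast
  qed
  show "Group.monoid L"
  proof (rule monoidI)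
    fix x y assume "x \<in> carrier L" "y \<in> carrier L"
    then show "x \<otimes>\<^bsub>L\<^esub> y \<in> carrier L"
      by (elim L_cases) (simp add: L_mult Cl_closed not_p)
  next
    fix x y z assume "x \<in> carrier L" "y \<in> carrier L" "z \<in> carrier L"
    then show "(x \<otimes>\<^bsub>L\<^esub> y) \<otimes>\<^bsub>L\<^esub> z = x \<otimes>\<^bsub>L\<^esub> (y \<otimes>\<^bsub>L\<^esub> z)"
      by (elim L_cases) (simp add: L_mult not_p algebra_simps)
  next
    fix x assume "x \<in> carrier L"
    then show "\<one>\<^bsub>L\<^esub> \<otimes>\<^bsub>L\<^esub> x = x" "x \<otimes>\<^bsub>L\<^esub> \<one>\<^bsub>L\<^esub> = x"
      by (elim L_cases; simp add: L_one L_mult not_p)+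
  qed (simp add: L_one Cl_closed not_p)
  fix x y z assume "x \<in> carrier L" "y \<in> carrier L" "z \<in> carrier L"
  then obtain a s b t c q where x: "x = Cl a s" "s \<notin> p" "y = Cl b t" "t \<notin> p" "z = Cl c q" "q \<notin> p"
    by (elim L_cases) blast
  show "(x \<oplus>\<^bsub>L\<^esub> y) \<otimes>\<^bsub>L\<^esub> z = x \<otimes>\<^bsub>L\<^esub> z \<oplus>\<^bsub>L\<^esub> y \<otimes>\<^bsub>L\<^esub> z"
    using x by (simp add: L_mult L_add not_p) (rule Cl_eqI; simp add: not_p algebra_simps)
  show "z \<otimes>\<^bsub>L\<^esub> (x \<oplus>\<^bsub>L\<^esub> y) = z \<otimes>\<^bsub>L\<^esub> x \<oplus>\<^bsub>L\<^esub> z \<otimes>\<^bsub>L\<^esub> y"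
    using x by (simp add: L_mult L_add not_p) (rule Cl_eqI; simp add: not_p algebra_simps)
qed

text \<open>The ideals of \<open>R\<close> that arise by contraction from \<open>(R/J)_p\<close>.
  The unit ideal is among them, as it must be for chains to compute the length.\<close>

definition saturated :: "'a set \<Rightarrow> bool" where
  "saturated I \<longleftrightarrow> ideal I R \<and> J \<subseteq> I \<and> (\<forall>s r. s \<notin> p \<longrightarrow> s * r \<in> I \<longrightarrow> r \<in> I)"

definition contr :: "('a set \<times> 'a set) set set \<Rightarrow> 'a set" where
  "contr C = {r. Cl r 1 \<in> C}"

definition ext :: "'a set \<Rightarrow> ('a set \<times> 'a set) set set" where
  "ext I = {Cl r s | r s. r \<in> I \<and> s \<notin> p}"

lemma saturated_contr:
  assumes C: "ideal C L"
  shows "saturated (contr C)"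
proof -
  interpret ideal C L by (rule C)
  have l: "Cl (r * a) t \<in> C" if "Cl a 1 \<in> C" "t \<notin> p" for r a t
    using I_l_closed[OF that(1) Cl_closed[OF that(2), of r]] that(2) by (simp add: L_mult not_p)
  have "ideal (contr C) R"
  proof (rule ideal_type_ringI)
    show "0 \<in> contr C" using additive_subgroup.zero_closed[OF additive_subgroup_axioms] by (simp add: contr_def L_zero)
    show "a + b \<in> contr C" if "a \<in> contr C" "b \<in> contr C" for a b
      using additive_subgroup.a_closed[OF additive_subgroup_axioms, of "Cl a 1" "Cl b 1"] that by (simp add: contr_def L_add not_p)
    show "r * a \<in> contr C" if "a \<in> contr C" for a r
      using l[of a 1 r] that by (simp add: contr_def not_p)
  qed
  moreover have "J \<subseteq> contr C"
  proof
    fix a assume "a \<in> J"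
    then have "Cl a 1 = Cl 0 1" by (subst Cl_eq_iff) (use not_p in \<open>auto intro: exI[of _ 1]\<close>)
    then show "a \<in> contr C"
      using additive_subgroup.zero_closed[OF additive_subgroup_axioms] by (simp add: contr_def L_zero)
  qed
  moreover have "r \<in> contr C" if "s \<notin> p" "s * r \<in> contr C" for s r
  proof -
    have "Cl (s * r) s \<in> C" using l[of "s * r" s 1] that by (simp add: contr_def)
    moreover have "Cl (s * r) s = Cl r 1" using that(1) not_p(1) by (rule Cl_eqI) simp
    ultimately show ?thesis by (simp add: contr_def)
  qed
  ultimately show ?thesis by (simp add: saturated_def)
qed

text \<open>Since \<open>s / 1\<close> is a unit for \<open>s\<close> outside \<open>p\<close>, an
  ideal contains \<open>r / s\<close> iff it contains \<open>r / 1\<close>; hence a contraction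
  determines its ideal.\<close>

lemma contr_strict_mono:
  assumes C: "ideal C L" and C': "ideal C' L" and sub: "C \<subset> C'"
  shows "contr C \<subset> contr C'"
proof -
  interpret C: ideal C L by (rule C)
  interpret C': ideal C' L by (rule C')
  have "contr C \<subseteq> contr C'" using sub by (auto simp: contr_def)
  moreover have "contr C \<noteq> contr C'"
  proof
    assume eq: "contr C = contr C'"
    obtain x where x: "x \<in> C'" "x \<notin> C" using sub by blast
    obtain r s where r: "x = Cl r s" "s \<notin> p" using C'.a_Hcarr[OF x(1)] by (rule L_cases)
    have "Cl s 1 \<otimes>\<^bsub>L\<^esub> x \<in> C'" using x Cl_closed by (intro C'.I_l_closed) (auto simp: not_p)
    moreover have "Cl s 1 \<otimes>\<^bsub>L\<^esub> x = Cl r 1"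
      using r by (simp add: L_mult not_p) (rule Cl_eqI; simp add: not_p)
    ultimately have "r \<in> contr C" unfolding eq by (simp add: contr_def)
    then have "Cl 1 s \<otimes>\<^bsub>L\<^esub> Cl r 1 \<in> C"
      using r Cl_closed by (intro C.I_l_closed) (auto simp: contr_def)
    then show False using r x by (simp add: L_mult not_p)
  qed
  ultimately show ?thesis by blast
qed

lemma ideal_ext:
  assumes I: "ideal I R"
  shows "ideal (ext I) L"
proof (rule idealI[OF ring_L])
  interpret L: ring L by (rule ring_L)
  note I = ideal_type_ringD[OF I]
  have l: "y \<otimes>\<^bsub>L\<^esub> x \<in> ext I" "x \<otimes>\<^bsub>L\<^esub> y \<in> ext I" if xI: "x \<in> ext I" and yL: "y \<in> carrier L" for x y
  proof -
    obtain a s where x: "x = Cl a s" "a \<in> I" "s \<notin> p" using xI by (auto simp: ext_def)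
    obtain b t where y: "y = Cl b t" "t \<notin> p" using yL by (rule L_cases)
    have "b * a \<in> I" "a * b \<in> I" "t * s \<notin> p" "s * t \<notin> p" using x y I(3,4) not_p(2) by blast+
    then show "y \<otimes>\<^bsub>L\<^esub> x \<in> ext I" "x \<otimes>\<^bsub>L\<^esub> y \<in> ext I"
      using x y by (auto simp: L_mult ext_def)
  qed
  show "subgroup (ext I) (add_monoid L)"
  proof (rule subgroup.intro)
    show "ext I \<subseteq> carrier (add_monoid L)" by (auto simp: ext_def Cl_closed)
    show "\<one>\<^bsub>add_monoid L\<^esub> \<in> ext I" using I(1) not_p by (auto simp: ext_def L_zero)
    show "x \<otimes>\<^bsub>add_monoid L\<^esub> y \<in> ext I" if xI: "x \<in> ext I" and yI: "y \<in> ext I" for x y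
    proof -
      obtain a s where a: "x = Cl a s" "a \<in> I" "s \<notin> p" using xI by (auto simp: ext_def)
      obtain b t where b: "y = Cl b t" "b \<in> I" "t \<notin> p" using yI by (auto simp: ext_def)
      note x = a b
      have "a * t + b * s \<in> I" "s * t \<notin> p" using x I(2,4) not_p(2) by blast+
      then show ?thesis using x by (auto simp: L_add ext_def)
    qed
    show "inv\<^bsub>add_monoid L\<^esub> x \<in> ext I" if x: "x \<in> ext I" for x
    proof -
      have c: "x \<in> carrier L" using x by (auto simp: ext_def Cl_closed)
      have "(\<ominus>\<^bsub>L\<^esub> \<one>\<^bsub>L\<^esub>) \<otimes>\<^bsub>L\<^esub> x \<in> ext I" using x by (intro l) auto
      moreover have "(\<ominus>\<^bsub>L\<^esub> \<one>\<^bsub>L\<^esub>) \<otimes>\<^bsub>L\<^esub> x = \<ominus>\<^bsub>L\<^esub> x"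
        using c by (simp add: L.l_minus)
      ultimately show ?thesis by (simp only: a_inv_def)
    qed
  qed
  show "y \<otimes>\<^bsub>L\<^esub> x \<in> ext I" "x \<otimes>\<^bsub>L\<^esub> y \<in> ext I" if "x \<in> ext I" "y \<in> carrier L" for x y
    using l that by blast+
qed

text \<open>If \<open>r / 1 = r' / s\<close> with \<open>r'\<close> in \<open>I\<close>, then
  \<open>u * s * r\<close> lies in \<open>I\<close> for some \<open>u\<close> outside
  \<open>p\<close>, because \<open>J\<close> is contained in \<open>I\<close>. Saturation removes
  \<open>u\<close> and \<open>s\<close>.\<close>

lemma ext_strict_mono:
  assumes I: "saturated I" and sub: "I \<subset> I'"
  shows "ext I \<subset> ext I'"
proof -
  obtain r where r: "r \<in> I'" "r \<notin> I" using sub by blast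
  have "Cl r 1 \<notin> ext I"
  proof
    assume "Cl r 1 \<in> ext I"
    then obtain r' s where s: "Cl r 1 = Cl r' s" "r' \<in> I" "s \<notin> p" by (auto simp: ext_def)
    then obtain u where u: "u \<notin> p" "u * (s * r - 1 * r') \<in> J" by (auto simp: Cl_eq_iff not_p)
    have "ideal I R" using I by (simp add: saturated_def)
    note i = ideal_type_ringD[OF this]
    have "u * (s * r - 1 * r') + u * r' \<in> I" 
      using u(2) I by (intro i(2) i(3)[OF s(2)]) (auto simp: saturated_def)
    then have "u * (s * r) \<in> I" by (simp add: right_diff_distrib)
    then show False using I u(1) s(3) r(2) unfolding saturated_def by blast
  qed
  moreover have "Cl r 1 \<in> ext I'" using r not_p by (auto simp: ext_def)
  moreover have "ext I \<subseteq> ext I'" using sub unfolding ext_def by blast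
  ultimately show ?thesis by blast
qed

text \<open>Contraction bounds the chains of the localization by chains of saturated ideals, and
  extension carries the chain \<open>T\<close> back. Strictness in both directions suffices, so the
  length can be computed in \<open>R\<close>.\<close>

lemma ring_length_L_eqI:
  assumes chain: "\<And>i. i \<le> n \<Longrightarrow> saturated (T i)" "\<And>i. i < n \<Longrightarrow> T i \<subset> T (Suc i)"
    and bound: "\<And>l c. (\<And>i. i \<le> l \<Longrightarrow> saturated (c i)) \<Longrightarrow> (\<And>i. i < l \<Longrightarrow> c i \<subset> c (Suc i)) \<Longrightarrow> l \<le> n"
  shows "ring_length L = enat n"
proof (rule antisym)
  show "ring_length L \<le> enat n"
    unfolding ring_length_def
  proof (rule Sup_least, clarify)
    fix l and c :: "nat \<Rightarrow> ('a set \<times> 'a set) set set"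
    assume c: "\<forall>i\<le>l. ideal (c i) L" "\<forall>i<l. c i \<subset> c (Suc i)"
    have "l \<le> n"
    proof (rule bound[of l "\<lambda>i. contr (c i)"])
      show "saturated (contr (c i))" if "i \<le> l" for i
        using c that by (intro saturated_contr) auto
      show "contr (c i) \<subset> contr (c (Suc i))" if "i < l" for i
        using c that by (intro contr_strict_mono) auto
    qed
    then show "enat l \<le> enat n" by simp
  qed
  have "ideal (ext (T i)) L" if "i \<le> n" for i
    using chain(1)[OF that] by (intro ideal_ext) (simp add: saturated_def)
  moreover have "ext (T i) \<subset> ext (T (Suc i))" if "i < n" for i
    using chain that by (intro ext_strict_mono) auto
  ultimately have "\<exists>c. (\<forall>i\<le>n. ideal (c i) L) \<and> (\<forall>i<n. c i \<subset> c (Suc i))"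
    by (intro exI[of _ "\<lambda>i. ext (T i)"]) simp
  then show "enat n \<le> ring_length L"
    unfolding ring_length_def by (intro Sup_upper) simp
qed

end

section \<open>Length at the prime of two variables\<close>

text \<open>The monomials \<open>x\<^sup>a z\<^sup>b\<close> with \<open>b < d\<close> are numbered by \<open>a d + b\<close>; those numbered from \<open>i\<close> on,
  together with \<open>z\<^sup>d\<close>, generate the \<open>i\<close>-th ideal of a filtration whose steps are simple
  after localization at \<open>(x, z)\<close>.\<close>

definition strip_mons :: "'n \<Rightarrow> 'n \<Rightarrow> nat \<Rightarrow> nat \<Rightarrow> ('n \<Rightarrow>\<^sub>0 nat) set" where
  "strip_mons x z d i = {m. d \<le> Poly_Mapping.lookup m z \<or> i \<le> Poly_Mapping.lookup m x * d + Poly_Mapping.lookup m z}"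

abbreviation strip_ideal :: "'n \<Rightarrow> 'n \<Rightarrow> nat \<Rightarrow> nat \<Rightarrow> (('n \<Rightarrow>\<^sub>0 nat) \<Rightarrow>\<^sub>0 'k::zero) set" where
  "strip_ideal x z d i \<equiv> supported (strip_mons x z d i)"

abbreviation strip_mon :: "'n \<Rightarrow> 'n \<Rightarrow> nat \<Rightarrow> nat \<Rightarrow> ('n \<Rightarrow>\<^sub>0 nat)" where
  "strip_mon x z d i \<equiv> Poly_Mapping.single x (i div d) + Poly_Mapping.single z (i mod d)"

lemma upset_strip_mons: "upset (strip_mons x z d i)"
  by (auto simp: upset_def strip_mons_def lookup_add algebra_simps intro: trans_le_add1 trans_le_add2)

lemma ideal_strip: "ideal (strip_ideal x z d i :: (('n \<Rightarrow>\<^sub>0 nat) \<Rightarrow>\<^sub>0 'k::comm_ring_1) set) ring_of_type_algebra"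
  by (rule ideal_supported[OF upset_strip_mons])

lemma strip_ideal_antimono: "i \<le> j \<Longrightarrow> strip_ideal x z d j \<subseteq> strip_ideal x z d i"
  by (rule supported_mono) (auto simp: strip_mons_def)

lemma strip_ideal_0: "strip_ideal x z d 0 = UNIV"
  by (auto simp: strip_mons_def supported_def)

text \<open>Such an \<open>m\<close> has number exactly \<open>i\<close> and exponent of
  \<open>z\<close> below \<open>d\<close>; division of \<open>i\<close> by \<open>d\<close> with
  remainder recovers its exponents of \<open>x\<close> and \<open>z\<close>, and the other variables
  are unrestricted.\<close>

lemma strip_mon_iff:
  assumes "x \<noteq> z" "d > 0"
  shows "m \<in> strip_mons x z d i - strip_mons x z d (Suc i) \<longleftrightarrow>
    (\<exists>l\<in>free_of {x, z}. m = l + strip_mon x z d i)" (is "?A \<longleftrightarrow> ?B")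
proof
  assume ?A
  then have m: "Poly_Mapping.lookup m z < d" "Poly_Mapping.lookup m x * d + Poly_Mapping.lookup m z = i"
    by (auto simp: strip_mons_def)
  then have i: "i mod d = Poly_Mapping.lookup m z" "i div d = Poly_Mapping.lookup m x" by auto
  show ?B
  proof
    show "m = (m - strip_mon x z d i) + strip_mon x z d i"
      by (rule poly_mapping_eqI) (use i assms in \<open>auto simp: lookup_add lookup_minus lookup_single when_def\<close>)
    show "m - strip_mon x z d i \<in> free_of {x, z}"
      using i assms by (auto simp: free_of_def lookup_minus lookup_add lookup_single when_def)
  qed
next
  assume ?B
  moreover have "i mod d < d" using assms by simp
  ultimately show ?A using assms
    by (auto simp: not_le strip_mons_def free_of_def lookup_add lookup_single when_def)
qed

text \<open>A quotient of consecutive strip ideals is free of rank one over the polynomials in the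
  remaining variables, with the class of \<open>strip_mon\<close> as basis. This lemma extracts the
  coefficient \<open>u\<close>; \<open>strip_leading\<close> is its uniqueness.\<close>

lemma strip_obtains:
  fixes f :: "('n \<Rightarrow>\<^sub>0 nat) \<Rightarrow>\<^sub>0 'k::comm_ring_1"
  assumes xz: "x \<noteq> z" "d > 0" and f: "f \<in> strip_ideal x z d i"
  obtains u f' where "f = u * Poly_Mapping.single (strip_mon x z d i) 1 + f'"
    "u \<in> supported (free_of {x, z})" "f' \<in> strip_ideal x z d (Suc i)"
proof -
  let ?A = "strip_mons x z d (Suc i)" and ?M = "strip_mon x z d i"
  have k: "\<exists>l\<in>free_of {x, z}. m = l + ?M" if "m \<in> Poly_Mapping.keys (restr (- ?A) f)" for m
    using strip_mon_iff[OF xz, of m i] that f by (auto simp: supported_def)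
  then have "restr (- ?A) f \<in> supported (multiples {?M})"
    unfolding supported_def multiples_def by blast
  then obtain u where u: "restr (- ?A) f = u * Poly_Mapping.single ?M 1" by (rule monomial_divisible)
  have "l \<in> free_of {x, z}" if "l \<in> Poly_Mapping.keys u" for l
    using k[of "l + ?M"] that unfolding u keys_mult_single by auto
  then have "u \<in> supported (free_of {x, z})" by (auto simp: supported_def)
  moreover have "restr ?A f \<in> strip_ideal x z d (Suc i)" by (simp add: supported_def)
  ultimately show ?thesis
    using that restr_add_restr_Compl[of "- ?A" f] u by (metis double_complement)
qed

lemma strip_leading:
  fixes u :: "('n \<Rightarrow>\<^sub>0 nat) \<Rightarrow>\<^sub>0 'k::comm_ring_1"
  assumes xz: "x \<noteq> z" "d > 0" and u: "u \<in> supported (free_of {x, z})"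
    and f: "u * Poly_Mapping.single (strip_mon x z d i) 1 \<in> strip_ideal x z d (Suc i)"
  shows "u = 0"
proof (rule ccontr)
  assume "u \<noteq> 0"
  then obtain l where l: "l \<in> Poly_Mapping.keys u" using keys_eq_empty by blast
  then have "l + strip_mon x z d i \<in> strip_mons x z d (Suc i)"
    using f by (auto simp: supported_def keys_mult_single)
  moreover have "l \<in> free_of {x, z}" using l u by (auto simp: supported_def)
  ultimately show False using strip_mon_iff[OF xz] by blast
qed

text \<open>Multiplication by \<open>z\<close> raises the number of a monomial by one and
  multiplication by \<open>x\<close> raises it by \<open>d\<close>; so \<open>(x, z)\<close>
  annihilates every step of the filtration.\<close>

lemma var_ideal_times_strip:
  fixes f s :: "('n \<Rightarrow>\<^sub>0 nat) \<Rightarrow>\<^sub>0 'k::comm_ring_1"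
  assumes "d > 0" "s \<in> var_ideal {x, z}" "f \<in> strip_ideal x z d i"
  shows "s * f \<in> strip_ideal x z d (Suc i)"
  using assms(2,3) unfolding var_ideal_def
proof (rule supported_mult)
  fix l m :: "'n \<Rightarrow>\<^sub>0 nat" assume l: "l \<in> - free_of {x, z}" and m: "m \<in> strip_mons x z d i"
  have "1 \<le> Poly_Mapping.lookup l x * d + Poly_Mapping.lookup l z"
    using l assms(1) by (auto simp: free_of_def Suc_le_eq)
  then show "l + m \<in> strip_mons x z d (Suc i)"
    using m by (auto simp: strip_mons_def lookup_add algebra_simps)
qed

text \<open>Climb the filtration. On the coefficient \<open>u\<close> of \<open>f\<close> at step
  \<open>j\<close> only the part \<open>s0\<close> of \<open>s\<close> free of \<open>x\<close> and
  \<open>z\<close> acts. From \<open>s * f\<close> one gets \<open>s0 * u = 0\<close>; as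
  \<open>s0\<close> is nonzero, \<open>u\<close> vanishes and \<open>f\<close> lies in the next
  ideal.\<close>

lemma strip_saturated:
  fixes f s :: "('n::finite \<Rightarrow>\<^sub>0 nat) \<Rightarrow>\<^sub>0 'k::idom"
  assumes xz: "x \<noteq> z" "d > 0" and s: "s \<notin> var_ideal {x, z}" and sf: "s * f \<in> strip_ideal x z d i"
  shows "f \<in> strip_ideal x z d i"
proof -
  have "f \<in> strip_ideal x z d j" if "j \<le> i" for j
    using that
  proof (induction j)
    case 0
    then show ?case by (simp add: strip_ideal_0)
  next
    case (Suc j)
    then have f: "f \<in> strip_ideal x z d j" by simp
    then obtain u f' where u: "f = u * Poly_Mapping.single (strip_mon x z d j) 1 + f'"
        "u \<in> supported (free_of {x, z})" "f' \<in> strip_ideal x z d (Suc j)"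
      by (rule strip_obtains[OF xz])
    obtain s0 s1 where s01: "s = s0 + s1" "s0 \<in> supported (free_of {x, z})" "s1 \<in> var_ideal {x, z}"
      by (rule split_var_ideal)
    note I = ideal_type_ringD[OF ideal_strip[of x z d "Suc j", where 'k = 'k]]
    have "s1 * f \<in> strip_ideal x z d (Suc j)"
      using xz(2) s01(3) f by (rule var_ideal_times_strip)
    moreover have "s * f \<in> strip_ideal x z d (Suc j)"
      by (rule subsetD[OF strip_ideal_antimono[OF Suc.prems] sf])
    ultimately have "s * f - (s1 * f + s0 * f') \<in> strip_ideal x z d (Suc j)"
      using u(3) by (intro I(6) I(2) I(3)[of f'])
    also have "s * f - (s1 * f + s0 * f') = (s0 * u) * Poly_Mapping.single (strip_mon x z d j) 1"
      by (simp add: s01(1) u(1) algebra_simps)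
    finally have "s0 * u = 0"
      using xz s01 u by (intro strip_leading supported_free_of_mult)
    moreover have "s0 \<noteq> 0" using s s01 by auto
    ultimately have "u = 0" by (simp add: mpoly_mult_eq_0_iff)
    then show ?case using u by simp
  qed
  then show ?thesis by simp
qed

text \<open>The ideal \<open>?T (c * d)\<close> is \<open>(x ^ c, z ^ d)\<close>. The hypotheses say
  that \<open>J\<close> has this localization: \<open>s\<close> becomes a unit, so
  \<open>x ^ c\<close> lies in every saturated ideal. The filtration above it then has
  \<open>c * d\<close> steps.\<close>

lemma ring_length_strip:
  fixes J :: "(('n::finite \<Rightarrow>\<^sub>0 nat) \<Rightarrow>\<^sub>0 'k::idom) set"
  assumes xz: "x \<noteq> z" and d: "d > 0" and J: "ideal J ring_of_type_algebra"
    and sub: "J \<subseteq> strip_ideal x z d (c * d)"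
    and s: "s \<notin> var_ideal {x, z}" "s * Poly_Mapping.single (Poly_Mapping.single x c) 1 \<in> J"
    and zd: "Poly_Mapping.single (Poly_Mapping.single z d) 1 \<in> J"
  shows "ring_length (quot_localized ring_of_type_algebra J (var_ideal {x, z})) = enat (c * d)"
proof -
  interpret localized_quotient J "var_ideal {x, z}"
    by (intro localized_quotient.intro ideal_of_type.intro localized_quotient_axioms.intro J prime_var_ideal)
  let ?n = "c * d"
  let ?T = "strip_ideal x z d :: nat \<Rightarrow> (('n \<Rightarrow>\<^sub>0 nat) \<Rightarrow>\<^sub>0 'k) set"
  have T_sub: "?T ?n \<subseteq> I" if I: "saturated I" for I
  proof (rule supported_subset_ideal)
    show i: "ideal I ring_of_type_algebra" using I by (simp add: saturated_def)
    have x: "Poly_Mapping.single (Poly_Mapping.single x c) 1 \<in> I"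
      using I s unfolding saturated_def by blast
    have z: "Poly_Mapping.single (Poly_Mapping.single z d) 1 \<in> I"
      using I zd unfolding saturated_def by blast
    fix m assume m: "m \<in> strip_mons x z d ?n"
    have "c \<le> Poly_Mapping.lookup m x \<or> d \<le> Poly_Mapping.lookup m z"
    proof (rule ccontr)
      assume "\<not> ?thesis"
      then have *: "Suc (Poly_Mapping.lookup m x) \<le> c" "Poly_Mapping.lookup m z < d" by auto
      have "Suc (Poly_Mapping.lookup m x) * d \<le> c * d" using *(1) by (rule mult_le_mono1)
      then show False using * m by (auto simp: strip_mons_def)
    qed
    moreover have "Poly_Mapping.single m 1 \<in> I"
      if "n \<le> Poly_Mapping.lookup m y" "Poly_Mapping.single (Poly_Mapping.single y n) 1 \<in> I" for y n
    proof -
      have "m = (m - Poly_Mapping.single y n) + Poly_Mapping.single y n"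
        by (rule poly_mapping_eqI) (use that in \<open>auto simp: lookup_add lookup_minus lookup_single when_def\<close>)
      then have "Poly_Mapping.single m (1::'k) =
          Poly_Mapping.single (m - Poly_Mapping.single y n) 1 * Poly_Mapping.single (Poly_Mapping.single y n) 1"
        by (simp add: mult_single)
      then show ?thesis using ideal_type_ringD(3)[OF i that(2)] by metis
    qed
    ultimately show "Poly_Mapping.single m 1 \<in> I" using x z by blast
  qed
  \<comment> \<open>The steps at which \<open>I\<close> has an element of order exactly
    \<open>i\<close>; their number plays the role of the length of \<open>I\<close> relative to the
    filtration.\<close>
  define jumps where "jumps I = {i. i < ?n \<and> \<not> I \<inter> ?T i \<subseteq> ?T (Suc i)}" for I
  have jumps_strict: "jumps I \<subset> jumps I'" if I: "saturated I" and I': "saturated I'" and II': "I \<subset> I'" for I I'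
  proof -
    have "jumps I \<noteq> jumps I'"
    proof
      assume eq: "jumps I = jumps I'"
      have i: "ideal I R" "ideal I' R" using I I' by (simp_all add: saturated_def)
      note i1 = ideal_type_ringD[OF i(1)] and i2 = ideal_type_ringD[OF i(2)]
      \<comment> \<open>Descending along the filtration: \<open>?T ?n\<close> lies in every
        saturated ideal, and \<open>?T 0\<close> is the whole ring.\<close>
      have "I' \<inter> ?T (?n - k) \<subseteq> I" for k
      proof (induction k)
        case 0
        then show ?case using T_sub[OF I] by auto
      next
        case (Suc k)
        show ?case
        proof (cases "k < ?n")
          case False
          then show ?thesis using Suc by simp
        next
          case True
          define j where "j = ?n - Suc k"
          have j: "Suc j = ?n - k" "j < ?n" using True by (auto simp: j_def)
          have "f \<in> I" if f: "f \<in> I'" "f \<in> ?T j" for f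
          proof (cases "f \<in> ?T (Suc j)")
            case True
            then show ?thesis using Suc f j by auto
          next
            case False
            then have "j \<in> jumps I" unfolding eq using f j by (auto simp: jumps_def)
            then obtain g where g: "g \<in> I" "g \<in> ?T j" "g \<notin> ?T (Suc j)" by (auto simp: jumps_def)
            obtain u f' where u: "f = u * Poly_Mapping.single (strip_mon x z d j) 1 + f'"
                "u \<in> supported (free_of {x, z})" "f' \<in> ?T (Suc j)"
              using xz d f(2) by (rule strip_obtains)
            obtain v g' where v: "g = v * Poly_Mapping.single (strip_mon x z d j) 1 + g'"
                "v \<in> supported (free_of {x, z})" "g' \<in> ?T (Suc j)"
              using xz d g(2) by (rule strip_obtains)
            note t = ideal_type_ringD[OF ideal_strip[of x z d "Suc j", where 'k = 'k]]
            have "v \<noteq> 0" using v g by auto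
            then have vp: "v \<notin> var_ideal {x, z}" using v(2) supported_free_of_var_ideal by blast
            \<comment> \<open>Cross-multiplying by the coefficients cancels the terms at step
              \<open>j\<close>, so the induction hypothesis applies to the difference. It yields
              \<open>v * f\<close> in \<open>I\<close>, and \<open>v\<close>, being nonzero and free
              of \<open>x\<close> and \<open>z\<close>, can be divided out.\<close>
            have "v * f - u * g = v * f' - u * g'" by (simp add: u(1) v(1) algebra_simps)
            then have "v * f - u * g \<in> ?T (Suc j)" using t(6)[OF t(3)[OF u(3)] t(3)[OF v(3)]] by simp
            moreover have "g \<in> I'" using g II' by blast
            then have "v * f - u * g \<in> I'" using f by (intro i2(6) i2(3))
            ultimately have "v * f - u * g \<in> I" using Suc j by auto
            then have "(v * f - u * g) + u * g \<in> I" using g by (intro i1(2) i1(3))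
            then have "v * f \<in> I" by simp
            then show ?thesis using I vp unfolding saturated_def by blast
          qed
          then show ?thesis unfolding j_def by blast
        qed
      qed
      from this[of ?n] have "I' \<subseteq> I" by (simp add: strip_ideal_0)
      then show False using II' by blast
    qed
    moreover have "jumps I \<subseteq> jumps I'" using II' unfolding jumps_def by blast
    ultimately show ?thesis by blast
  qed
  show ?thesis
  \<comment> \<open>The index is reversed because the strip ideals decrease: the chain rises from
    \<open>(x ^ c, z ^ d)\<close> to the unit ideal.\<close>
  proof (rule ring_length_L_eqI[of _ "\<lambda>i. ?T (?n - i)"])
    fix i assume "i \<le> ?n"
    have J_sub: "J \<subseteq> ?T (?n - i)" using sub strip_ideal_antimono[of "?n - i" ?n] by (meson diff_le_self order_trans)
    show "saturated (?T (?n - i))"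
      unfolding saturated_def by (intro conjI allI impI ideal_strip J_sub) (rule strip_saturated[OF xz d])
  next
    fix i assume i: "i < ?n"
    define j where "j = ?n - Suc i"
    have j: "Suc j = ?n - i" using i by (simp add: j_def)
    have "strip_mon x z d j \<in> strip_mons x z d j - strip_mons x z d (Suc j)"
      using strip_mon_iff[OF xz d] zero_in_free_of add_0 by metis
    then have "Poly_Mapping.single (strip_mon x z d j) 1 \<in> ?T j" "Poly_Mapping.single (strip_mon x z d j) 1 \<notin> ?T (Suc j)"
      by auto
    moreover have "?T (Suc j) \<subseteq> ?T j" by (rule strip_ideal_antimono) simp
    ultimately have "?T (Suc j) \<subset> ?T j" by blast
    then show "?T (?n - i) \<subset> ?T (?n - Suc i)" unfolding j by (simp add: j_def)
  next
    fix l and C :: "nat \<Rightarrow> (('n \<Rightarrow>\<^sub>0 nat) \<Rightarrow>\<^sub>0 'k) set"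
    assume C: "\<And>i. i \<le> l \<Longrightarrow> saturated (C i)" "\<And>i. i < l \<Longrightarrow> C i \<subset> C (Suc i)"
    have fin: "finite (jumps I)" for I by (rule finite_subset[of _ "{..<?n}"]) (auto simp: jumps_def)
    have "i \<le> l \<Longrightarrow> i \<le> card (jumps (C i))" for i
    proof (induction i)
      case (Suc i)
      then have "jumps (C i) \<subset> jumps (C (Suc i))" by (intro jumps_strict C) auto
      then have "card (jumps (C i)) < card (jumps (C (Suc i)))" by (rule psubset_card_mono[OF fin])
      then show ?case using Suc by simp
    qed simp
    from this[of l] have "l \<le> card (jumps (C l))" by simp
    also have "\<dots> \<le> card {..<?n}" by (rule card_mono) (auto simp: jumps_def)
    finally show "l \<le> ?n" by simp
  qed
qed

section \<open>Multiplicity at a prime of variables\<close>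

text \<open>Stars and bars, after listing the exponents of the variables outside \<open>V\<close>.
  As \<open>V\<close> is proper, subtracting one is exact and the count is positive, which also
  yields finiteness.\<close>

lemma card_monomials:
  fixes V :: "'n::finite set"
  assumes "V \<noteq> UNIV"
  shows "finite {m \<in> free_of V. mon_degree m = t}"
    "card {m \<in> free_of V. mon_degree m = t} = (t + (card (- V) - 1)) choose (card (- V) - 1)"
proof -
  let ?k = "card (- V)"
  obtain xs where xs: "set xs = - V" "distinct xs" using finite_distinct_list[of "- V"] by auto
  then have len: "length xs = ?k" using distinct_card by metis
  have k: "?k > 0" using assms finite[of "- V"] by (subst card_gt_0_iff) blast
  let ?L = "{l::nat list. length l = ?k \<and> sum_list l = t}" and ?M = "{m \<in> free_of V. mon_degree m = t}"
  have deg: "mon_degree m = sum_list (map (Poly_Mapping.lookup m) xs)" if "m \<in> free_of V" for m :: "'n \<Rightarrow>\<^sub>0 nat"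
  proof -
    have "mon_degree m = sum (Poly_Mapping.lookup m) (- V)"
      unfolding mon_degree_def by (rule sum.mono_neutral_right) (use that in \<open>auto simp: free_of_def\<close>)
    then show ?thesis using xs by (simp add: sum_list_distinct_conv_sum_set)
  qed
  have bij: "bij_betw (\<lambda>m. map (Poly_Mapping.lookup m) xs) ?M ?L"
  proof (rule bij_betw_imageI)
    show "inj_on (\<lambda>m. map (Poly_Mapping.lookup m) xs) ?M"
    proof (rule inj_onI, rule poly_mapping_eqI)
      fix m m' :: "'n \<Rightarrow>\<^sub>0 nat" and i
      assume "m \<in> ?M" "m' \<in> ?M" "map (Poly_Mapping.lookup m) xs = map (Poly_Mapping.lookup m') xs"
      then show "Poly_Mapping.lookup m i = Poly_Mapping.lookup m' i"
        using xs(1) by (cases "i \<in> V") (auto simp: free_of_def)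
    qed
    show "(\<lambda>m. map (Poly_Mapping.lookup m) xs) ` ?M = ?L"
    proof (intro equalityI subsetI)
      fix l assume "l \<in> (\<lambda>m. map (Poly_Mapping.lookup m) xs) ` ?M"
      then show "l \<in> ?L" using deg len by auto
    next
      fix l assume l: "l \<in> ?L"
      define m where "m = (\<Sum>j<?k. Poly_Mapping.single (xs ! j) (l ! j))"
      have "Poly_Mapping.lookup m (xs ! i) = l ! i" if "i < ?k" for i
      proof -
        have "Poly_Mapping.lookup m (xs ! i) = (\<Sum>j<?k. if j = i then l ! i else 0)"
          unfolding m_def lookup_sum
          by (rule sum.cong) (use xs(2) len that in \<open>auto simp: lookup_single when_def nth_eq_iff_index_eq\<close>)
        then show ?thesis using that by simp
      qed
      then have ml: "map (Poly_Mapping.lookup m) xs = l"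
        using l len by (auto intro: nth_equalityI)
      have "m \<in> free_of V"
        unfolding free_of_def
      proof (intro CollectI ballI)
        fix i assume "i \<in> V"
        then have "xs ! j \<noteq> i" if "j < ?k" for j
          using nth_mem[of j xs] that xs(1) len by auto
        then show "Poly_Mapping.lookup m i = 0"
          unfolding m_def lookup_sum by (intro sum.neutral) (simp add: lookup_single when_def)
      qed
      then show "l \<in> (\<lambda>m. map (Poly_Mapping.lookup m) xs) ` ?M"
        using ml deg l by force
    qed
  qed
  have c: "card ?L = (t + ?k - 1) choose t" by (rule card_length_sum_list)
  moreover have "\<dots> > 0" using k by simp
  ultimately have "finite ?L" by (metis card_ge_0_finite)
  then show "finite ?M" using bij bij_betw_finite by blast
  have "card ?M = card ?L" using bij by (rule bij_betw_same_card)
  also have "\<dots> = (t + (?k - 1)) choose t" using c k by (simp add: Nat.add_diff_assoc)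
  also have "\<dots> = (t + (?k - 1)) choose (?k - 1)"
    using binomial_symmetric[of t "t + (?k - 1)"] by simp
  finally show "card ?M = (t + (?k - 1)) choose (?k - 1)" .
qed

text \<open>The classes of the monomials of degree \<open>t\<close> free of \<open>V\<close> form a
  basis: other terms vanish modulo the ideal, and these are independent because no nonzero
  combination lies in it.\<close>

lemma hilbert_function_var_ideal:
  fixes V :: "'n::finite set"
  assumes V: "V \<noteq> UNIV"
  shows "hilbert_function (var_ideal V :: ('n, 'k::field) mpoly set) t = card {m \<in> free_of V. mon_degree m = t}"
proof -
  let ?I = "var_ideal V :: ('n, 'k) mpoly set"
  interpret ideal_of_type ?I by (rule ideal_of_type.intro[OF ideal_var_ideal])
  interpret Q: ring Q using ideal.quotient_is_ring[OF J] .
  interpret k: Ring.field "ring_of_type_algebra :: 'k ring" by (rule field_from_type_algebra)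
  let ?\<pi> = "\<lambda>f. ?I +>\<^bsub>R\<^esub> f"
  let ?h = "\<lambda>c. ?\<pi> (Poly_Mapping.single 0 c)"
  interpret h: ring_hom_ring "ring_of_type_algebra :: 'k ring" Q ?h
    by (rule ring_hom_ringI) (auto simp: Q_simps k.ring_axioms Q.ring_axioms mult_single single_add)
  have I1: "1 \<notin> ?I" using prime_var_ideal by (rule primeideal_type_ringD)
  \<comment> \<open>The scalars are the image of \<open>k\<close> in the quotient, a field because
    the quotient is not the zero ring.\<close>
  have "subfield (?h ` carrier (ring_of_type_algebra :: 'k ring)) Q"
  proof (rule h.img_is_subfield)
    show "\<one>\<^bsub>Q\<^esub> \<noteq> \<zero>\<^bsub>Q\<^esub>" using I1 unfolding Q_simps coset_eq_iff by simp
  qed (rule k.carrier_is_subfield)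
  then have K: "subfield (range ?h) Q" by simp
  \<comment> \<open>Stated for any finite set of monomials so that induction can add them one at a
    time.\<close>
  have dim: "Q.dimension (card M) (range ?h) (?\<pi> ` supported M)" if "finite M" "M \<subseteq> free_of V" for M
    using that
  proof (induction M)
    case empty
    then show ?case using Q.zero_dim[of "range ?h"] by (simp add: Q_simps)
  next
    case (insert m M)
    let ?v = "?\<pi> (Poly_Mapping.single m 1)"
    have "?v \<notin> ?\<pi> ` supported M"
    proof
      assume "?v \<in> ?\<pi> ` supported M"
      then obtain f where f: "f \<in> supported M" "Poly_Mapping.single m 1 - f \<in> ?I"
        by (auto simp: coset_eq_iff)
      have "m \<in> Poly_Mapping.keys (Poly_Mapping.single m 1 - f)"
      proof -
        have "m \<notin> Poly_Mapping.keys f" using f(1) insert.hyps by (auto simp: supported_def)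
        then show ?thesis by (simp add: in_keys_iff lookup_minus)
      qed
      then show False using f(2) insert.prems by (auto simp: var_ideal_def supported_def)
    qed
    then have "Q.dimension (Suc (card M)) (range ?h) (Q.line_extension (range ?h) ?v (?\<pi> ` supported M))"
      using insert by (intro Q.Suc_dim) (auto simp: Q_simps)
    moreover have "Q.line_extension (range ?h) ?v (?\<pi> ` supported M) = ?\<pi> ` supported (insert m M)"
    proof (intro equalityI subsetI)
      fix y assume "y \<in> Q.line_extension (range ?h) ?v (?\<pi> ` supported M)"
      then obtain c f where y: "y = ?h c \<otimes>\<^bsub>Q\<^esub> ?v \<oplus>\<^bsub>Q\<^esub> ?\<pi> f" "f \<in> supported M"
        by (auto simp: Q.line_extension_def set_add_def' r_coset_def)
      then have "y = ?\<pi> (Poly_Mapping.single m c + f)" by (simp add: Q_simps mult_single)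
      moreover have "Poly_Mapping.single m c + f \<in> supported (insert m M)"
        using y(2) by (intro supported_add) (auto simp: supported_def)
      ultimately show "y \<in> ?\<pi> ` supported (insert m M)" by blast
    next
      fix y assume "y \<in> ?\<pi> ` supported (insert m M)"
      then obtain f where f: "y = ?\<pi> f" "f \<in> supported (insert m M)" by blast
      have "f = Poly_Mapping.single 0 (Poly_Mapping.lookup f m) * Poly_Mapping.single m 1 + restr (- {m}) f"
        by (rule poly_mapping_eqI) (auto simp: mult_single lookup_add lookup_single when_def lookup_restr)
      then have "y = ?h (Poly_Mapping.lookup f m) \<otimes>\<^bsub>Q\<^esub> ?v \<oplus>\<^bsub>Q\<^esub> ?\<pi> (restr (- {m}) f)"
        using f(1) by (simp add: Q_simps)
      moreover have "restr (- {m}) f \<in> supported M" using f(2) by (auto simp: supported_def)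
      ultimately show "y \<in> Q.line_extension (range ?h) ?v (?\<pi> ` supported M)"
        by (auto simp: Q.line_extension_def set_add_def' r_coset_def)
    qed
    ultimately show ?case using insert.hyps by simp
  qed
  let ?M = "{m \<in> free_of V. mon_degree m = t}"
  have "?\<pi> ` {f. homogeneous (int t) f} = ?\<pi> ` supported ?M"
  proof (intro equalityI subsetI)
    fix y assume "y \<in> ?\<pi> ` {f. homogeneous (int t) f}"
    then obtain f where f: "y = ?\<pi> f" "homogeneous (int t) f" by blast
    have "f - restr (free_of V) f \<in> ?I"
      using restr_add_restr_Compl[of "free_of V" f]
      by (simp add: algebra_simps var_ideal_def supported_def) (metis Int_lower2 add_diff_cancel_left' keys_restr)
    then have "y = ?\<pi> (restr (free_of V) f)" using f by (simp add: coset_eq_iff)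
    moreover have "restr (free_of V) f \<in> supported ?M" using f(2) by (auto simp: supported_def homogeneous_def)
    ultimately show "y \<in> ?\<pi> ` supported ?M" by blast
  next
    fix y assume "y \<in> ?\<pi> ` supported ?M"
    then show "y \<in> ?\<pi> ` {f. homogeneous (int t) f}" by (auto simp: supported_def homogeneous_def)
  qed
  then have "hilbert_function ?I t = Q.dim (range ?h) (?\<pi> ` supported ?M)"
    by (simp add: hilbert_function_def)
  also have "\<dots> = card ?M"
    using Q.dimI[OF K dim[OF card_monomials(1)[OF V, of t]]] by (simp add: over_def)
  finally show ?thesis .
qed

section \<open>From the Hilbert function to the multiplicity\<close>

lemma fact_add_prod: "fact (t + q) = fact t * (\<Prod>i=1..q. real t + real i)"
  by (induction q) (simp_all add: algebra_simps)

text \<open>A polynomial vanishing at all large integers is zero, so the description by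
  \<open>THE\<close> has a unique solution.\<close>

lemma hilbert_polynomial_eqI:
  assumes "\<And>t. poly P (real t) = real (hilbert_function I t)"
  shows "hilbert_polynomial I = P"
  unfolding hilbert_polynomial_def
proof (rule the_equality)
  fix P' assume "\<forall>\<^sub>F t in sequentially. poly P' (real t) = real (hilbert_function I t)"
  then obtain N where N: "\<And>t. t \<ge> N \<Longrightarrow> poly P' (real t) = poly P (real t)"
    using assms by (auto simp: eventually_sequentially)
  show "P' = P"
  proof (rule ccontr)
    assume "P' \<noteq> P"
    then have "finite {x. poly (P' - P) x = 0}" by (intro poly_roots_finite) simp
    moreover have "real ` {N..} \<subseteq> {x. poly (P' - P) x = 0}" using N by auto
    ultimately have "finite (real ` {N..})" by (rule finite_subset[rotated])
    then show False using finite_imageD[of real "{N..}"] infinite_Ici[of N] by (simp add: inj_on_def)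
  qed
qed (simp add: assms)

lemma multiplicity_var_ideal:
  fixes V :: "'n::finite set"
  assumes V: "V \<noteq> UNIV"
  shows "multiplicity_quot (var_ideal V :: ('n, 'k::field) mpoly set) = 1"
proof -
  define q where "q = card (- V) - 1"
  \<comment> \<open>This is \<open>(t + q) choose q\<close> as a polynomial in \<open>t\<close>. The
    \<open>q\<close> factors are monic, so the leading coefficient \<open>1 / fact q\<close> cancels
    the factorial in the multiplicity.\<close>
  define P where "P = Polynomial.smult (1 / fact q) (\<Prod>i=1..q. [:real i, 1:])"
  have "poly P (real t) = real (hilbert_function (var_ideal V :: ('n, 'k) mpoly set) t)" for t
  proof -
    have "poly P (real t) = (\<Prod>i=1..q. real t + real i) / fact q"
      by (simp add: P_def poly_prod add.commute)
    also have "\<dots> = fact (t + q) / (fact q * fact t)" by (simp add: fact_add_prod)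
    also have "\<dots> = real ((t + q) choose q)" using binomial_fact[of q "t + q", where 'a = real] by simp
    finally show ?thesis
      by (simp add: hilbert_function_var_ideal[OF V] card_monomials(2)[OF V] q_def)
  qed
  then have "hilbert_polynomial (var_ideal V :: ('n, 'k) mpoly set) = P" by (rule hilbert_polynomial_eqI)
  moreover have "degree P = q" by (simp add: P_def degree_prod_eq_sum_degree)
  moreover have "lead_coeff P = 1 / fact q" by (simp add: P_def lead_coeff_prod)
  moreover have "P \<noteq> 0" using \<open>lead_coeff P = 1 / fact q\<close> by auto
  ultimately show ?thesis by (simp add: multiplicity_quot_def Let_def)
qed

section \<open>The monomial construction\<close>

lemma multiples_iff:
  fixes m :: "'n \<Rightarrow>\<^sub>0 nat"
  shows "m \<in> multiples G \<longleftrightarrow> (\<exists>g\<in>G. \<forall>i. Poly_Mapping.lookup g i \<le> Poly_Mapping.lookup m i)"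
proof
  assume "m \<in> multiples G"
  then obtain l g where "g \<in> G" "m = l + g" by (auto simp: multiples_def)
  then show "\<exists>g\<in>G. \<forall>i. Poly_Mapping.lookup g i \<le> Poly_Mapping.lookup m i"
    by (intro bexI[of _ g]) (simp_all add: lookup_add)
next
  assume "\<exists>g\<in>G. \<forall>i. Poly_Mapping.lookup g i \<le> Poly_Mapping.lookup m i"
  then obtain g where g: "g \<in> G" "\<And>i. Poly_Mapping.lookup g i \<le> Poly_Mapping.lookup m i" by blast
  have "m = (m - g) + g"
    by (rule poly_mapping_eqI) (simp add: lookup_add lookup_minus g(2))
  then show "m \<in> multiples G" unfolding multiples_def using g(1) by blast
qed

lemma mon_degree_add: "mon_degree (m + l) = mon_degree m + mon_degree l"
  by (simp add: mon_degree_def lookup_add sum.distrib)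

lemma mon_degree_single [simp]: "mon_degree (Poly_Mapping.single i n) = n"
  by (simp add: mon_degree_def lookup_single when_def)

lemma lookup_le_mon_degree: "Poly_Mapping.lookup m x \<le> mon_degree m"
  unfolding mon_degree_def by (rule member_le_sum) auto

lemma lookup_add_le_mon_degree:
  assumes "x \<noteq> y"
  shows "Poly_Mapping.lookup m x + Poly_Mapping.lookup m y \<le> mon_degree m"
proof -
  have "(\<Sum>i\<in>{x, y}. Poly_Mapping.lookup m i) \<le> mon_degree m"
    unfolding mon_degree_def by (rule sum_mono2) auto
  then show ?thesis using assms by simp
qed

lemma var_power: "(var i :: ('n \<Rightarrow>\<^sub>0 nat) \<Rightarrow>\<^sub>0 'k::comm_ring_1) ^ n = Poly_Mapping.single (Poly_Mapping.single i n) 1"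
  by (induction n) (simp_all add: mult_single flip: single_add)

text \<open>A divisor of a monomial is a monomial; its exponents are bounded by those of both
  powers, which share no variable. What remains is a nonzero constant.\<close>

lemma gcd_disjoint_powers:
  fixes g :: "('n::finite, 'k::field) mpoly"
  assumes "x \<noteq> z" "g dvd Poly_Mapping.single (Poly_Mapping.single x a) 1" "g dvd Poly_Mapping.single (Poly_Mapping.single z b) 1"
  shows "g dvd 1"
proof -
  obtain m c m1 where m: "g = Poly_Mapping.single m c" "c \<noteq> 0" "Poly_Mapping.single x a = m + m1"
    using assms(2) by (rule dvd_single_obtains) simp
  obtain l c' l1 where l: "g = Poly_Mapping.single l c'" "c' \<noteq> 0" "Poly_Mapping.single z b = l + l1"
    using assms(3) by (rule dvd_single_obtains) simp
  have "Poly_Mapping.keys g = {m}" "Poly_Mapping.keys g = {l}"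
    by (simp add: m) (use l in simp)
  then have "m = l" by simp
  then have "Poly_Mapping.lookup m i \<le> Poly_Mapping.lookup (Poly_Mapping.single x a) i"
    "Poly_Mapping.lookup m i \<le> Poly_Mapping.lookup (Poly_Mapping.single z b) i" for i
    unfolding m(3) l(3) by (simp_all add: lookup_add)
  then have "Poly_Mapping.lookup m i = 0" for i
    using assms(1) by (metis le_zero_eq lookup_single_not_eq)
  then have "m = 0" by (intro poly_mapping_eqI) simp
  then have "g * Poly_Mapping.single 0 (inverse c) = 1"
    using m by (simp add: mult_single)
  then show ?thesis by (metis dvdI)
qed

text \<open>In terms of the degrees, \<open>a = d1\<close>, \<open>c = d1 + d2 - e\<close>,
  \<open>b = e - d1 = d2 - c\<close> and \<open>d = d3\<close>. The condition \<open>c < a\<close>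
  expresses \<open>d2 < e\<close>.\<close>

context
  fixes x y z :: "'n::finite" and a b c d :: nat and m1 m2 m3 :: "'n \<Rightarrow>\<^sub>0 nat"
  assumes xyz: "x \<noteq> y" "x \<noteq> z" "y \<noteq> z" and b: "b > 0" and ca: "c < a" and d: "d > 0"
  defines "m1 \<equiv> Poly_Mapping.single x a"
    and "m2 \<equiv> Poly_Mapping.single x c + Poly_Mapping.single y b"
    and "m3 \<equiv> Poly_Mapping.single z d"
begin

lemma lookup_m:
  "Poly_Mapping.lookup m1 i = (if i = x then a else 0)"
  "Poly_Mapping.lookup m2 i = (if i = x then c else if i = y then b else 0)"
  "Poly_Mapping.lookup m3 i = (if i = z then d else 0)"
  using xyz by (auto simp: m1_def m2_def m3_def lookup_add lookup_single when_def)

text \<open>The exponent \<open>b\<close> of \<open>y\<close> keeps \<open>m2\<close> from dividing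
  \<open>m1\<close>, and \<open>c < a\<close> keeps \<open>m1\<close> from dividing
  \<open>m2\<close>; \<open>m3\<close> involves a variable absent from both.\<close>

lemma m_not_multiples: "m1 \<notin> multiples {m2, m3}" "m2 \<notin> multiples {m1, m3}" "m3 \<notin> multiples {m1, m2}"
proof -
  show "m1 \<notin> multiples {m2, m3}"
    using xyz b d by (auto simp: multiples_iff lookup_m dest: spec[of _ y] spec[of _ z])
  show "m2 \<notin> multiples {m1, m3}"
    using xyz ca d by (auto simp: multiples_iff lookup_m dest: spec[of _ x] spec[of _ z])
  show "m3 \<notin> multiples {m1, m2}"
    using xyz ca b by (auto simp: multiples_iff lookup_m dest: spec[of _ x] spec[of _ y])
qed

definition mon_J :: "('n, 'k::field) mpoly set" where
  "mon_J = supported (multiples {m1, m2, m3})"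

lemma single_in_mon_J: "m \<in> {m1, m2, m3} \<Longrightarrow> Poly_Mapping.single m 1 \<in> mon_J"
  by (auto simp: mon_J_def multiples_iff)

lemma ideal_mon_J: "ideal (mon_J :: ('n, 'k::field) mpoly set) ring_of_type_algebra"
  unfolding mon_J_def by (rule ideal_supported[OF upset_multiples])

lemma minimally_generates_mon_J:
  "minimally_generates (Poly_Mapping.single m1 1, Poly_Mapping.single m2 1, Poly_Mapping.single m3 1)
    (mon_J :: ('n, 'k::field) mpoly set)"
proof -
  have i: "Idl\<^bsub>mpoly_ring\<^esub> {Poly_Mapping.single m1 1, Poly_Mapping.single m2 1, Poly_Mapping.single m3 1} =
      (mon_J :: ('n, 'k) mpoly set)"
    using genideal_monomials[of "{m1, m2, m3}", where 'b = 'k] by (simp add: mon_J_def)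
  have n: "Idl\<^bsub>mpoly_ring\<^esub> {Poly_Mapping.single l 1, Poly_Mapping.single l' 1} \<noteq> (mon_J :: ('n, 'k) mpoly set)"
    if "m \<in> {m1, m2, m3}" "m \<notin> multiples {l, l'}" for m l l'
  proof -
    have "Poly_Mapping.single m 1 \<notin> (supported (multiples {l, l'}) :: ('n, 'k) mpoly set)"
      using that(2) by simp
    moreover have "Poly_Mapping.single m 1 \<in> (mon_J :: ('n, 'k) mpoly set)"
      using that(1) by (rule single_in_mon_J)
    moreover have "Idl\<^bsub>mpoly_ring\<^esub> {Poly_Mapping.single l 1, Poly_Mapping.single l' 1} =
        (supported (multiples {l, l'}) :: ('n, 'k) mpoly set)"
      using genideal_monomials[of "{l, l'}", where 'b = 'k] by simp
    ultimately show ?thesis by metis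
  qed
  show ?thesis
    unfolding minimally_generates_def
    using i n[of m1 m2 m3] n[of m2 m1 m3] n[of m3 m1 m2] m_not_multiples by simp
qed

text \<open>Each term of a summand must be cancelled by a term of another one. A term of
  \<open>a3\<close> is then divisible by \<open>x ^ a\<close> or by \<open>x ^ c * y ^ b\<close>, so
  it has degree at least \<open>d1\<close>, and \<open>q\<close> is at least \<open>d1 + d3\<close>,
  which is at least \<open>e\<close>. Once \<open>a3 = 0\<close>, terms of \<open>a1\<close> are
  divisible by \<open>y ^ b\<close> and terms of \<open>a2\<close> by \<open>x ^ (a - c)\<close>,
  and both force \<open>q\<close> to be at least \<open>a + b\<close>.\<close>

lemma mon_J_syz_bound:
  fixes a1 a2 a3 :: "('n, 'k::field) mpoly" and d1 d2 d3 e q :: int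
  assumes deg: "d1 = int a" "d2 = int (c + b)" "d3 = int d" "e = int (a + b)" and dd: "d1 \<le> d2" "d2 \<le> d3"
    and hom: "homogeneous (q - d1) a1" "homogeneous (q - d2) a2" "homogeneous (q - d3) a3"
    and syz: "a1 * Poly_Mapping.single m1 1 + a2 * Poly_Mapping.single m2 1 + a3 * Poly_Mapping.single m3 1 = 0"
    and q: "q < e"
  shows "a1 = 0" "a2 = 0" "a3 = 0"
proof -
  have share: "(\<exists>k'\<in>Poly_Mapping.keys u. k + m = k' + l) \<or> (\<exists>k'\<in>Poly_Mapping.keys v. k + m = k' + l')"
    if sum: "f * Poly_Mapping.single m 1 + u * Poly_Mapping.single l 1 + v * Poly_Mapping.single l' 1 = 0" and k: "k \<in> Poly_Mapping.keys f"
    for f u v :: "('n, 'k) mpoly" and m l l' k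
  proof (rule ccontr)
    assume "\<not> ?thesis"
    then have "k + m \<notin> Poly_Mapping.keys (u * Poly_Mapping.single l 1)" "k + m \<notin> Poly_Mapping.keys (v * Poly_Mapping.single l' 1)"
      unfolding keys_mult_single by auto
    then have "Poly_Mapping.lookup (f * Poly_Mapping.single m 1) (k + m) = 0"
      using arg_cong[OF sum, of "\<lambda>h. Poly_Mapping.lookup h (k + m)"] by (simp add: lookup_add in_keys_iff)
    then show False using k by (simp add: lookup_mult_single in_keys_iff)
  qed
  have lk: "Poly_Mapping.lookup k i + Poly_Mapping.lookup m i = Poly_Mapping.lookup k' i + Poly_Mapping.lookup l i"
    if "k + m = k' + l" for k m k' l :: "'n \<Rightarrow>\<^sub>0 nat" and i
    using arg_cong[OF that, of "\<lambda>h. Poly_Mapping.lookup h i"] by (simp add: lookup_add)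
  show a3: "a3 = 0"
  proof (rule ccontr)
    assume "a3 \<noteq> 0"
    then obtain k where k: "k \<in> Poly_Mapping.keys a3" using keys_eq_empty by blast
    have "a3 * Poly_Mapping.single m3 1 + a1 * Poly_Mapping.single m1 1 + a2 * Poly_Mapping.single m2 1 = 0"
      using syz by (simp add: ac_simps)
    from share[OF this k] obtain k' where "k + m3 = k' + m1 \<or> k + m3 = k' + m2" by blast
    then have "a \<le> Poly_Mapping.lookup k x \<or> c \<le> Poly_Mapping.lookup k x \<and> b \<le> Poly_Mapping.lookup k y"
    proof
      assume "k + m3 = k' + m1"
      from lk[OF this, of x] show ?thesis using xyz by (simp add: lookup_m)
    next
      assume "k + m3 = k' + m2"
      from lk[OF this, of x] lk[OF this, of y] show ?thesis using xyz by (simp add: lookup_m)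
    qed
    moreover have "Poly_Mapping.lookup k x + Poly_Mapping.lookup k y \<le> mon_degree k" using xyz(1) by (rule lookup_add_le_mon_degree)
    moreover have "int (mon_degree k) = q - d3" using hom(3) k by (simp add: homogeneous_def)
    ultimately show False using deg dd q by linarith
  qed
  show "a1 = 0"
  proof (rule ccontr)
    assume "a1 \<noteq> 0"
    then obtain k where k: "k \<in> Poly_Mapping.keys a1" using keys_eq_empty by blast
    from share[OF syz k] a3 obtain k' where "k + m1 = k' + m2" by auto
    from lk[OF this, of y] have "b \<le> Poly_Mapping.lookup k y" using xyz by (simp add: lookup_m)
    moreover have "Poly_Mapping.lookup k y \<le> mon_degree k" by (rule lookup_le_mon_degree)
    moreover have "int (mon_degree k) = q - d1" using hom(1) k by (simp add: homogeneous_def)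
    ultimately show False using deg q by linarith
  qed
  show "a2 = 0"
  proof (rule ccontr)
    assume "a2 \<noteq> 0"
    then obtain k where k: "k \<in> Poly_Mapping.keys a2" using keys_eq_empty by blast
    have "a2 * Poly_Mapping.single m2 1 + a1 * Poly_Mapping.single m1 1 + a3 * Poly_Mapping.single m3 1 = 0"
      using syz by (simp add: ac_simps)
    from share[OF this k] a3 obtain k' where "k + m2 = k' + m1" by auto
    from lk[OF this, of x] have "a \<le> Poly_Mapping.lookup k x + c" using xyz by (simp add: lookup_m)
    moreover have "Poly_Mapping.lookup k x \<le> mon_degree k" by (rule lookup_le_mon_degree)
    moreover have "int (mon_degree k) = q - d2" using hom(2) k by (simp add: homogeneous_def)
    ultimately show False using deg q by linarith
  qed
qed

lemma indeg_mon_J: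
  fixes d1 d2 d3 e :: int
  assumes deg: "d1 = int a" "d2 = int (c + b)" "d3 = int d" "e = int (a + b)" and dd: "d1 \<le> d2" "d2 \<le> d3"
  shows "indeg_syz (d1, d2, d3) (Poly_Mapping.single m1 1 :: ('n, 'k::field) mpoly, Poly_Mapping.single m2 1, Poly_Mapping.single m3 1) = e"
  unfolding indeg_syz_def
proof (rule Least_equality)
  let ?f = "(Poly_Mapping.single m1 1 :: ('n, 'k) mpoly, Poly_Mapping.single m2 1, Poly_Mapping.single m3 1)"
  \<comment> \<open>The Koszul relation of \<open>f1\<close> and \<open>f2\<close> divided by
    \<open>x ^ c\<close>.\<close>
  let ?s = "(Poly_Mapping.single (Poly_Mapping.single y b) 1 :: ('n, 'k) mpoly,
    Poly_Mapping.single (Poly_Mapping.single x (a - c)) (- 1) :: ('n, 'k) mpoly, 0 :: ('n, 'k) mpoly)"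
  have "Poly_Mapping.single y b + m1 = Poly_Mapping.single x (a - c) + m2"
    by (rule poly_mapping_eqI) (use ca xyz in \<open>auto simp: lookup_add lookup_m lookup_single when_def\<close>)
  then have "?s \<in> syz_component (d1, d2, d3) ?f e"
    using deg ca by (simp add: homogeneous_def mult_single flip: single_add)
  moreover have "?s \<noteq> (0, 0, 0)"
    by (metis lookup_single_eq lookup_zero one_neq_zero prod.inject)
  ultimately show "syz_component (d1, d2, d3) ?f e \<noteq> {(0, 0, 0)}" by (metis singletonD)
  fix q assume ne: "syz_component (d1, d2, d3) ?f q \<noteq> {(0, 0, 0)}"
  have "(0, 0, 0) \<in> syz_component (d1, d2, d3) ?f q" by (simp add: homogeneous_def)
  then obtain a1 a2 a3 where s: "(a1, a2, a3) \<in> syz_component (d1, d2, d3) ?f q" "(a1, a2, a3) \<noteq> (0, 0, 0)"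
    using ne by auto
  show "e \<le> q"
  proof (rule ccontr)
    assume "\<not> e \<le> q"
    then show False using mon_J_syz_bound[OF deg dd, of q a1 a2 a3] s by auto
  qed
qed

section \<open>Associated primes and the codimension-two degree\<close>

lemma prime_contains_mon_J:
  fixes p :: "('n, 'k::field) mpoly set"
  assumes p: "p \<in> Ass_Quot mpoly_ring mon_J"
  shows "primeideal p mpoly_ring" "mon_J \<subseteq> p" "var_ideal {x, z} \<subseteq> p"
proof -
  show prime: "primeideal p mpoly_ring" using p by (simp add: Ass_Quot_def)
  show sub: "mon_J \<subseteq> p"
    using p ideal_type_ringD(4)[OF ideal_mon_J] by (auto simp: Ass_Quot_def)
  have "(var x :: ('n, 'k) mpoly) ^ a \<in> p" "(var z :: ('n, 'k) mpoly) ^ d \<in> p"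
    unfolding var_power using sub single_in_mon_J[of m1] single_in_mon_J[of m3] by (auto simp: m1_def m3_def)
  then have "var x \<in> p" "var z \<in> p" using primeideal_type_ringD(4)[OF prime] by blast+
  then show "var_ideal {x, z} \<subseteq> p"
    by (intro var_ideal_subset primeideal_type_ringD(1)[OF prime]) auto
qed

lemma var_ideal_in_Ass:
  assumes c: "c > 0"
  shows "var_ideal {x, z} \<in> Ass_Quot mpoly_ring (mon_J :: ('n, 'k::field) mpoly set)"
proof -
  \<comment> \<open>With \<open>y ^ b\<close> already present, \<open>m2\<close> is missing just one
    factor \<open>x\<close> and \<open>m3\<close> just one factor \<open>z\<close>. So multiplying
    by either variable enters the ideal, while the other variables never do; \<open>c > 0\<close>
    makes \<open>c - 1\<close> a true predecessor.\<close>
  define w where "w = Poly_Mapping.single x (c - 1) + Poly_Mapping.single y b + Poly_Mapping.single z (d - 1)"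
  have lw: "Poly_Mapping.lookup w i = (if i = x then c - 1 else if i = y then b else if i = z then d - 1 else 0)" for i
    using xyz by (auto simp: w_def lookup_add lookup_single when_def)
  have multiples_w: "l + w \<in> multiples {m1, m2, m3} \<longleftrightarrow> l \<notin> free_of {x, z}" for l
  proof
    assume "l + w \<in> multiples {m1, m2, m3}"
    then consider "\<And>i. Poly_Mapping.lookup m1 i \<le> Poly_Mapping.lookup l i + Poly_Mapping.lookup w i"
      | "\<And>i. Poly_Mapping.lookup m2 i \<le> Poly_Mapping.lookup l i + Poly_Mapping.lookup w i"
      | "\<And>i. Poly_Mapping.lookup m3 i \<le> Poly_Mapping.lookup l i + Poly_Mapping.lookup w i"
      unfolding multiples_iff lookup_add[of l] by blast
    then show "l \<notin> free_of {x, z}"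
    proof cases
      case 1
      from 1[of x] show ?thesis using ca c by (auto simp: free_of_def lookup_m lw)
    next
      case 2
      from 2[of x] show ?thesis using c by (auto simp: free_of_def lookup_m lw)
    next
      case 3
      from 3[of z] show ?thesis using d xyz by (auto simp: free_of_def lookup_m lw)
    qed
  next
    assume "l \<notin> free_of {x, z}"
    then have "(\<forall>i. Poly_Mapping.lookup m2 i \<le> Poly_Mapping.lookup l i + Poly_Mapping.lookup w i) \<or>
      (\<forall>i. Poly_Mapping.lookup m3 i \<le> Poly_Mapping.lookup l i + Poly_Mapping.lookup w i)"
      using xyz c d by (auto simp: free_of_def lookup_m lw)
    then show "l + w \<in> multiples {m1, m2, m3}"
      unfolding multiples_iff lookup_add[of l] by blast
  qed
  have "r \<in> var_ideal {x, z} \<longleftrightarrow> r * Poly_Mapping.single w 1 \<in> mon_J" for r :: "('n, 'k) mpoly"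
    using multiples_w unfolding var_ideal_def mon_J_def supported_def mem_Collect_eq keys_mult_single by blast
  then show ?thesis
    unfolding Ass_Quot_def using prime_var_ideal[of "{x, z}", where 'k = 'k] by auto
qed

text \<open>For \<open>c = 0\<close> the ideal contains \<open>y ^ b\<close>, which lies outside
  \<open>(x, z)\<close>, so the sum is empty. Otherwise \<open>(x, z)\<close> is its only index,
  with length \<open>c * d\<close> and multiplicity one.\<close>

lemma codim2_degree_mon_J:
  "codim2_degree (mon_J :: ('n, 'k::field) mpoly set) = ereal (real (c * d))"
proof -
  let ?P = "{p. p \<in> Ass_Quot mpoly_ring (mon_J :: ('n, 'k) mpoly set) \<and> height mpoly_ring p = 2}"
  let ?p = "var_ideal {x, z} :: ('n, 'k) mpoly set"
  have sub: "?P \<subseteq> {?p}"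
  proof
    fix p assume p: "p \<in> ?P"
    then have "primeideal p mpoly_ring" "?p \<subseteq> p" using prime_contains_mon_J by blast+
    then show "p \<in> {?p}" using height_gt_2[OF xyz(2)] p by blast
  qed
  show ?thesis
  proof (cases "c = 0")
    case True
    have "?p \<notin> ?P"
    proof
      assume "?p \<in> ?P"
      then have "mon_J \<subseteq> ?p" using prime_contains_mon_J(2) by blast
      then have "Poly_Mapping.single m2 1 \<in> ?p" using single_in_mon_J[of m2] by auto
      then show False using xyz True by (simp add: var_ideal_def free_of_def lookup_m)
    qed
    then have "?P = {}" using sub by blast
    then have "codim2_degree (mon_J :: ('n, 'k) mpoly set) = 0"
      by (simp only: codim2_degree_def sum.empty)
    then show ?thesis using True by simp
  next
    case False
    then have "?P = {?p}"
      using sub var_ideal_in_Ass[where 'k = 'k] height_var_ideal_2[OF xyz(2), where 'k = 'k] by blast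
    then have "codim2_degree (mon_J :: ('n, 'k) mpoly set) =
        (\<Sum>p\<in>{?p}. ereal_of_enat (ring_length (quot_localized mpoly_ring mon_J p)) * ereal (multiplicity_quot p))"
      by (simp only: codim2_degree_def)
    moreover have "multiplicity_quot ?p = 1"
      using xyz by (intro multiplicity_var_ideal) auto
    moreover have "ring_length (quot_localized mpoly_ring mon_J ?p) = enat (c * d)"
    proof (rule ring_length_strip[OF xyz(2) d ideal_mon_J])
      have "multiples {m1, m2, m3} \<subseteq> strip_mons x z d (c * d)"
      proof
        fix m assume "m \<in> multiples {m1, m2, m3}"
        then obtain g where g: "g \<in> {m1, m2, m3}" "\<And>i. Poly_Mapping.lookup g i \<le> Poly_Mapping.lookup m i"
          unfolding multiples_iff by blast
        have "c \<le> Poly_Mapping.lookup m x \<or> d \<le> Poly_Mapping.lookup m z"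
          using g(1) g(2)[of x] g(2)[of z] ca by (auto simp: lookup_m)
        then show "m \<in> strip_mons x z d (c * d)"
          unfolding strip_mons_def using mult_le_mono1[THEN trans_le_add1] by blast
      qed
      then show "mon_J \<subseteq> (strip_ideal x z d (c * d) :: ('n, 'k) mpoly set)"
        unfolding mon_J_def by (rule supported_mono)
      \<comment> \<open>The factor \<open>y ^ b\<close> serves as \<open>s\<close>: it lies outside
        \<open>(x, z)\<close>, and its product with \<open>x ^ c\<close> is the generator
        \<open>m2\<close>.\<close>
      show "Poly_Mapping.single (Poly_Mapping.single y b) 1 \<notin> ?p"
        using xyz by (simp add: var_ideal_def free_of_def lookup_single)
      show "Poly_Mapping.single (Poly_Mapping.single y b) 1 * Poly_Mapping.single (Poly_Mapping.single x c) 1 \<in> (mon_J :: ('n, 'k) mpoly set)"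
        using single_in_mon_J[of m2] by (simp add: mult_single m2_def add.commute)
      show "Poly_Mapping.single (Poly_Mapping.single z d) 1 \<in> (mon_J :: ('n, 'k) mpoly set)"
        using single_in_mon_J[of m3] by (simp add: m3_def)
    qed
    ultimately show ?thesis by simp
  qed
qed

end

theorem theorem1p10:
  fixes d1 d2 d3 e :: int
  assumes "card (UNIV :: 'n set) \<ge> 3"
    and "1 \<le> d1" and "d1 \<le> d2" and "d2 \<le> d3"
    and "d2 < e" and "e \<le> d1 + d2"
  shows "realizable TYPE('n::finite) TYPE('k::{alg_closed_field, field_char_0})
           (d1, d2, d3) (e, (d1 + d2 - e) * d3)"
proof -
  obtain A where "A \<subseteq> (UNIV :: 'n set)" "card A = 3" using obtain_subset_with_card_n[OF assms(1)] by blast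
  then obtain x y z :: 'n where xyz: "x \<noteq> y" "x \<noteq> z" "y \<noteq> z" by (auto simp: card_3_iff)
  \<comment> \<open>No truncation occurs: \<open>e > d2\<close> and \<open>d2 \<ge> d1\<close> make
    \<open>e - d1\<close> positive, and \<open>e \<le> d1 + d2\<close> makes \<open>c\<close>
    nonnegative.\<close>
  define a b c d where "a = nat d1" and "b = nat (e - d1)" and "c = nat (d1 + d2 - e)" and "d = nat d3"
  have deg: "d1 = int a" "d2 = int (c + b)" "d3 = int d" "e = int (a + b)"
    and pos: "b > 0" "c < a" "d > 0"
    using assms by (auto simp: a_def b_def c_def d_def)
  let ?f1 = "Poly_Mapping.single (Poly_Mapping.single x a) 1 :: ('n, 'k) mpoly"
  let ?f2 = "Poly_Mapping.single (Poly_Mapping.single x c + Poly_Mapping.single y b) 1 :: ('n, 'k) mpoly"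
  let ?f3 = "Poly_Mapping.single (Poly_Mapping.single z d) 1 :: ('n, 'k) mpoly"
  have "homogeneous d1 ?f1" "homogeneous d2 ?f2" "homogeneous d3 ?f3"
    using deg by (simp_all add: homogeneous_def mon_degree_add)
  moreover have "\<forall>g. g dvd ?f1 \<and> g dvd ?f2 \<and> g dvd ?f3 \<longrightarrow> g dvd 1"
    using gcd_disjoint_powers[OF xyz(2)] by blast
  moreover have "indeg_syz (d1, d2, d3) (?f1, ?f2, ?f3) = e"
    using xyz pos deg assms(3,4) by (rule indeg_mon_J)
  moreover have "real_of_int ((d1 + d2 - e) * d3) = real (c * d)"
    using deg by simp
  ultimately show ?thesis
    unfolding realizable_def
    using minimally_generates_mon_J[OF xyz pos, where 'k = 'k] codim2_degree_mon_J[OF xyz pos, where 'k = 'k]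
    by auto
qed

end
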